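(* Let $\varphi:\mathbb{R}^{m\times n}\to\mathbb{R}$ be a finite-valued convex function and let $F(L)=\|L\|_*+\varphi(L)$. Let $L\in\mathbb{R}^{m\times n}$ have rank $\rho$ and full singular value decomposition $$L=\begin{bmatrix}U_1&U_2\end{bmatrix}\begin{bmatrix}\Sigma_1&0\\ 0&0\end{bmatrix}\begin{bmatrix}V_1^T\\ V_2^T\end{bmatrix},$$ with $U_1\in\mathbb{R}^{m\times\rho}$, $V_1\in\mathbb{R}^{n\times\rho}$, and $\Sigma_1$ the $\rho\times\rho$ diagonal matrix of nonzero singular values. Let $D\in\partial\varphi(L)$. (1) There exists $\mathcal{E}\in\partial\|L\|_*+\partial\varphi(L)=\partial F(L)$ such that $$\|\mathcal{E}\|_F^2=\min_{X\in\partial\|L\|_*}\|X+D\|_F^2=\|I+U_1^TDV_1\|_F^2+\|U_1^TDV_2\|_F^2+\|U_2^TDV_1\|_F^2+\min_{\|W'\|\le 1}\|U_2^TDV_2-W'\|_F^2,$$ where the last minimum is over matrices $W'\in\mathbb{R}^{(m-\rho)\times(n-\rho)}$ with spectral norm at most $1$. (2) Suppose in addition that $\varphi(L)=\min_{S\in\mathbb{R}^{m\times n}}\left\{\tfrac12\|\mathcal{A}(L+S)-b\|_2^2+\|S\|_1\right\}$ for a linear operator $\mathcal{A}:\mathbb{R}^{m\times n}\to\mathbb{R}^d$ and $b\in\mathbb{R}^d$. Let $L^\star$ be any minimizer of $F$, let $F^\star=F(L^\star)$, and let $F_{\mathrm{bound}}$ be any real number with $F^\star\le F_{\mathrm{bound}}$.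 Then for every $\mathcal{E}$ as in (1), $$F(L)-F(L^\star)\le\|\mathcal{E}\|_F\,\|L-L^\star\|_F\le\|\mathcal{E}\|_F\left(\|L\|_F+F_{\mathrm{bound}}\right).$$
   Context: $\|\cdot\|_*$ is the nuclear norm (sum of singular values), $\|\cdot\|_F$ the Frobenius norm, $\|\cdot\|$ the spectral norm, and $\|S\|_1$ the sum of absolute values of the entries of $S$. $\partial$ denotes the convex subdifferential with respect to the trace inner product $\langle A,B\rangle=\operatorname{trace}(A^TB)$; $\partial\|L\|_*$ is the subdifferential of the nuclear norm at $L$. $I$ is the $\rho\times\rho$ identity matrix. Norms of blocks having no rows or no columns are $0$. *)

theory Defs
  imports
    "HOL-Library.Set_Algebras"
    "Jordan_Normal_Form.Char_Poly"
    "Jordan_Normal_Form.DL_Rank"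
begin

definition mat_trace :: "real mat \<Rightarrow> real" where
  "mat_trace A = (\<Sum>i<dim_row A. A $$ (i, i))"

definition trace_inner :: "real mat \<Rightarrow> real mat \<Rightarrow> real" where
  "trace_inner A B = mat_trace (transpose_mat A * B)"

definition vec_norm2 :: "real vec \<Rightarrow> real" where
  "vec_norm2 v = sqrt (v \<bullet> v)"

definition fro_norm :: "real mat \<Rightarrow> real" where
  "fro_norm A = sqrt (\<Sum>i<dim_row A. \<Sum>j<dim_col A. (A $$ (i, j))\<^sup>2)"

definition entry_l1_norm :: "real mat \<Rightarrow> real" where
  "entry_l1_norm A = (\<Sum>i<dim_row A. \<Sum>j<dim_col A. \<bar>A $$ (i, j)\<bar>)"

text \<open>
  Square roots of the eigenvalues of the Gram matrix, with algebraic multiplicity. The multiset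
  has one element per column of the matrix, so for a wide matrix it contains more zeros than in
  the convention with min(rows, columns) singular values; this changes neither norm below.
\<close>
definition singular_values :: "real mat \<Rightarrow> real multiset" where
  "singular_values A = image_mset sqrt (proots (char_poly (transpose_mat A * A)))"

definition nuclear_norm :: "real mat \<Rightarrow> real" where
  "nuclear_norm A = sum_mset (singular_values A)"

text \<open>Inserting 0 only matters for matrices without columns, whose norm is 0.\<close>
definition spectral_norm :: "real mat \<Rightarrow> real" where
  "spectral_norm A = Max (insert 0 (set_mset (singular_values A)))"

definition mat_convex_fun :: "nat \<Rightarrow> nat \<Rightarrow> (real mat \<Rightarrow> real) \<Rightarrow> bool" where
  "mat_convex_fun m n f \<longleftrightarrow>
     (\<forall>X\<in>carrier_mat m n. \<forall>Y\<in>carrier_mat m n. \<forall>t::real. 0 \<le> t \<and> t \<le> 1 \<longrightarrow>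
        f ((1 - t) \<cdot>\<^sub>m X + t \<cdot>\<^sub>m Y) \<le> (1 - t) * f X + t * f Y)"

definition subdifferential :: "nat \<Rightarrow> nat \<Rightarrow> (real mat \<Rightarrow> real) \<Rightarrow> real mat \<Rightarrow> real mat set" where
  "subdifferential m n f L =
     {G \<in> carrier_mat m n. \<forall>Z\<in>carrier_mat m n. f Z \<ge> f L + trace_inner G (Z - L)}"

text \<open>\<open>is_min_value f S v\<close>: the minimum of \<open>f\<close> over \<open>S\<close> exists (is attained) and equals \<open>v\<close>.\<close>
definition is_min_value :: "('a \<Rightarrow> real) \<Rightarrow> 'a set \<Rightarrow> real \<Rightarrow> bool" where
  "is_min_value f S v \<longleftrightarrow> (\<exists>x\<in>S. f x = v) \<and> (\<forall>x\<in>S. v \<le> f x)"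

definition mat_linear_operator :: "nat \<Rightarrow> nat \<Rightarrow> nat \<Rightarrow> (real mat \<Rightarrow> real vec) \<Rightarrow> bool" where
  "mat_linear_operator m n d T \<longleftrightarrow>
     (\<forall>X\<in>carrier_mat m n. T X \<in> carrier_vec d) \<and>
     (\<forall>X\<in>carrier_mat m n. \<forall>Y\<in>carrier_mat m n. T (X + Y) = T X + T Y) \<and>
     (\<forall>X\<in>carrier_mat m n. \<forall>c. T (c \<cdot>\<^sub>m X) = c \<cdot>\<^sub>v T X)"

definition append_cols :: "real mat \<Rightarrow> real mat \<Rightarrow> real mat" where
  "append_cols A B = four_block_mat A B (0\<^sub>m 0 (dim_col A)) (0\<^sub>m 0 (dim_col B))"

text \<open>The library's \<open>orthogonal_mat\<close> does not require the columns to be normalized.\<close>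
definition orthonormal_mat :: "nat \<Rightarrow> real mat \<Rightarrow> bool" where
  "orthonormal_mat k Q \<longleftrightarrow>
     Q \<in> carrier_mat k k \<and> transpose_mat Q * Q = 1\<^sub>m k \<and> Q * transpose_mat Q = 1\<^sub>m k"

definition full_svd ::
  "nat \<Rightarrow> nat \<Rightarrow> nat \<Rightarrow> real mat \<Rightarrow> real mat \<Rightarrow> real mat \<Rightarrow> real mat \<Rightarrow> real mat \<Rightarrow> real mat \<Rightarrow> bool" where
  "full_svd m n \<rho> L U1 U2 \<Sigma>1 V1 V2 \<longleftrightarrow>
     U1 \<in> carrier_mat m \<rho> \<and> U2 \<in> carrier_mat m (m - \<rho>) \<and>
     V1 \<in> carrier_mat n \<rho> \<and> V2 \<in> carrier_mat n (n - \<rho>) \<and>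
     orthonormal_mat m (append_cols U1 U2) \<and> orthonormal_mat n (append_cols V1 V2) \<and>
     \<Sigma>1 \<in> carrier_mat \<rho> \<rho> \<and> diagonal_mat \<Sigma>1 \<and> (\<forall>i<\<rho>. \<Sigma>1 $$ (i, i) > 0) \<and>
     L = append_cols U1 U2
         * four_block_mat \<Sigma>1 (0\<^sub>m \<rho> (n - \<rho>)) (0\<^sub>m (m - \<rho>) \<rho>) (0\<^sub>m (m - \<rho>) (n - \<rho>))
         * (transpose_mat V1 @\<^sub>r transpose_mat V2)"

end

theory Submission
  imports Defs "Jordan_Normal_Form.Spectral_Radius"
begin

text \<open>
  The nuclear norm is the dual norm of the spectral norm: its value at \<open>Z\<close> is the maximum of
  \<open>\<langle>G, Z\<rangle>\<close> over all contractions \<open>G\<close> (\<open>trace_inner_le_nuclear_norm\<close>, \<open>nuclear_norm_attained\<close>).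
  This rests on the spectral theorem for the Gram matrix \<open>Z\<^sup>T Z\<close> (\<open>real_spectral_theorem\<close>), which
  supplies an orthonormal basis that \<open>Z\<close> maps to orthogonal vectors of lengths \<open>s\<^sub>i\<close>, the singular
  values.

  Duality determines the subdifferential of the nuclear norm at \<open>L\<close>
  (\<open>subdifferential_nuclear_norm_iff\<close>): a subgradient is a contraction \<open>X\<close> with
  \<open>\<langle>X, L\<rangle> = \<parallel>L\<parallel>\<^sub>*\<close>, hence maps each \<open>v\<^sub>i\<close> to \<open>u\<^sub>i\<close>, and \<open>X\<^sup>T\<close> maps \<open>u\<^sub>i\<close> back to \<open>v\<^sub>i\<close>. In the bases
  \<open>(U1, U2)\<close> and \<open>(V1, V2)\<close> it thus has the diagonal blocks \<open>I\<close> and \<open>W\<close>, with an arbitrary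
  contraction \<open>W\<close>, and zero blocks elsewhere. Since the Frobenius norm is invariant under orthogonal
  changes of basis, the squared norm of \<open>X + D\<close> is the sum over the four blocks
  (\<open>fro_norm_sq_subgradient_add\<close>), where \<open>W\<close> only affects the last one. Minimizing over \<open>X\<close> is
  therefore projecting \<open>U2\<^sup>T D V2\<close> onto the spectral unit ball, and truncating the singular values
  at 1 is such a projection (\<open>spectral_ball_projection\<close>).

  The identity \<open>\<partial>\<parallel>L\<parallel>\<^sub>* + \<partial>\<phi>(L) = \<partial>F(L)\<close> is the sum rule of convex analysis for finite convex
  functions (\<open>subdifferential_sum_rule\<close>). It follows from a sandwich theorem
  (\<open>sandwich_linear\<close>) whose linear functional is built one matrix entry at a time. With it,
  the bound on \<open>F L - F Lstar\<close> is the subgradient inequality together with Cauchy-Schwarz, and the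
  second bound uses \<open>\<parallel>Lstar\<parallel>\<^sub>F \<le> \<parallel>Lstar\<parallel>\<^sub>* \<le> F Lstar\<close>, valid because \<open>\<phi> \<ge> 0\<close> in that situation.
\<close>

section \<open>The spectral theorem for real symmetric matrices\<close>

lemma scalar_prod_self_nonneg: "(v :: real vec) \<bullet> v \<ge> 0"
  by (simp add: scalar_prod_def sum_nonneg)

lemma scalar_prod_self_eq_0:
  fixes v :: "real vec"
  assumes v: "v \<in> carrier_vec n" and "v \<bullet> v = 0"
  shows "v = 0\<^sub>v n"
proof (rule eq_vecI)
  fix i assume "i < dim_vec (0\<^sub>v n :: real vec)"
  then have i: "i < n" by simp
  have "\<forall>i\<in>{0..<n}. v $ i * v $ i = 0"
    using assms by (subst sum_nonneg_eq_0_iff[symmetric]) (auto simp: scalar_prod_def)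
  with i show "v $ i = 0\<^sub>v n $ i" by simp
qed (use v in simp)

text \<open>
  Associativity with hypotheses on dimensions instead of carriers: the simplifier computes the
  dimensions of a product, but it would have to guess the intermediate sizes in the carrier form.
\<close>
lemma mult_mat_assoc:
  fixes A :: "'a :: semiring_0 mat"
  assumes "dim_col A = dim_row B" "dim_col B = dim_row C"
  shows "A * B * C = A * (B * C)"
  by (rule assoc_mult_mat[of A "dim_row A" "dim_row B" B "dim_row C" C "dim_col C"])
    (rule carrier_matI; simp only: assms)+

lemma mult_mat_vec_assoc:
  fixes A :: "'a :: semiring_0 mat"
  assumes "dim_col A = dim_row B" "dim_vec v = dim_col B"
  shows "A * B *\<^sub>v v = A *\<^sub>v (B *\<^sub>v v)"
  by (rule assoc_mult_mat_vec[of A "dim_row A" "dim_row B" B "dim_col B"])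
    ((rule carrier_matI carrier_vecI; simp only: assms)+)

lemma transpose_mult_dim:
  fixes A :: "'a :: comm_semiring_0 mat"
  assumes "dim_col A = dim_row B"
  shows "transpose_mat (A * B) = transpose_mat B * transpose_mat A"
  by (rule transpose_mult[of A "dim_row A" "dim_row B" B "dim_col B"])
    (rule carrier_matI; simp only: assms)+

lemma orthonormal_matD:
  assumes "orthonormal_mat k Q"
  shows "Q \<in> carrier_mat k k" "transpose_mat Q * Q = 1\<^sub>m k" "Q * transpose_mat Q = 1\<^sub>m k"
  using assms by (auto simp: orthonormal_mat_def)

lemma orthonormal_mat_mult:
  assumes P: "orthonormal_mat k P" and Q: "orthonormal_mat k Q"
  shows "orthonormal_mat k (P * Q)"
proof -
  note p = orthonormal_matD[OF P] and q = orthonormal_matD[OF Q]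
  have t: "transpose_mat (P * Q) = transpose_mat Q * transpose_mat P"
    by (rule transpose_mult[OF p(1) q(1)])
  have "transpose_mat (P * Q) * (P * Q) = transpose_mat Q * ((transpose_mat P * P) * Q)"
    unfolding t using p(1) q(1)
    by (simp add: assoc_mult_mat[of _ k k _ k _ k])
  moreover have "(P * Q) * transpose_mat (P * Q) = P * ((Q * transpose_mat Q) * transpose_mat P)"
    unfolding t using p(1) q(1)
    by (simp add: assoc_mult_mat[of _ k k _ k _ k])
  ultimately show ?thesis
    using p q by (simp add: orthonormal_mat_def left_mult_one_mat[of _ k k])
qed

text \<open>
  A complex eigenvector \<open>u + i v\<close> for \<open>a + i b\<close> satisfies \<open>A u = a u - b v\<close> and
  \<open>A v = b u + a v\<close>. Symmetry equates \<open>v \<bullet> A u\<close> with \<open>A v \<bullet> u\<close>, which leaves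
  \<open>b (u \<bullet> u + v \<bullet> v) = 0\<close>. So \<open>b = 0\<close>, and whichever of \<open>u\<close>, \<open>v\<close> is nonzero is a real
  eigenvector.
\<close>
lemma symmetric_real_eigenvector:
  fixes A :: "real mat"
  assumes A: "A \<in> carrier_mat n n" and sym: "transpose_mat A = A" and n: "n > 0"
  obtains e v where "v \<in> carrier_vec n" "v \<bullet> v = 1" "A *\<^sub>v v = e \<cdot>\<^sub>v v"
proof -
  define C where "C = map_mat complex_of_real A"
  have C: "C \<in> carrier_mat n n" using A by (simp add: C_def)
  from spectrum_non_empty[OF C n] obtain k x where "eigenvector C x k"
    by (auto simp: spectrum_def eigenvalue_def)
  then have x: "x \<in> carrier_vec n" "x \<noteq> 0\<^sub>v n" and Cx: "C *\<^sub>v x = k \<cdot>\<^sub>v x"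
    using C by (auto simp: eigenvector_def)
  define u where "u = map_vec Re x"
  define v where "v = map_vec Im x"
  have u: "u \<in> carrier_vec n" and v: "v \<in> carrier_vec n" using x by (auto simp: u_def v_def)
  have Cxi: "(\<Sum>j<n. complex_of_real (A $$ (i,j)) * x $ j) = k * x $ i" if "i < n" for i
  proof -
    have "(C *\<^sub>v x) $ i = (k \<cdot>\<^sub>v x) $ i" using Cx by simp
    then show ?thesis using that A x
      by (simp add: C_def scalar_prod_def atLeast0LessThan)
  qed
  have Au: "A *\<^sub>v u = Re k \<cdot>\<^sub>v u - Im k \<cdot>\<^sub>v v"
  proof (rule eq_vecI)
    fix i assume "i < dim_vec (Re k \<cdot>\<^sub>v u - Im k \<cdot>\<^sub>v v)"
    then have i: "i < n" using v by simp
    show "(A *\<^sub>v u) $ i = (Re k \<cdot>\<^sub>v u - Im k \<cdot>\<^sub>v v) $ i"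
      using arg_cong[OF Cxi[OF i], of Re] i A x
      by (simp add: u_def v_def scalar_prod_def atLeast0LessThan)
  qed (use A u v in simp)
  have Av: "A *\<^sub>v v = Im k \<cdot>\<^sub>v u + Re k \<cdot>\<^sub>v v"
  proof (rule eq_vecI)
    fix i assume "i < dim_vec (Im k \<cdot>\<^sub>v u + Re k \<cdot>\<^sub>v v)"
    then have i: "i < n" using v by simp
    show "(A *\<^sub>v v) $ i = (Im k \<cdot>\<^sub>v u + Re k \<cdot>\<^sub>v v) $ i"
      using arg_cong[OF Cxi[OF i], of Im] i A x
      by (simp add: u_def v_def scalar_prod_def atLeast0LessThan)
  qed (use A u v in simp)
  have "v \<bullet> (A *\<^sub>v u) = (A *\<^sub>v v) \<bullet> u"
    using transpose_vec_mult_scalar[OF A u v] sym by simp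
  then have "Re k * (v \<bullet> u) - Im k * (v \<bullet> v) = Im k * (u \<bullet> u) + Re k * (v \<bullet> u)"
    unfolding Au Av using u v
    by (simp add: scalar_prod_minus_distrib[of _ n] add_scalar_prod_distrib[of _ n])
  then have im: "Im k * (u \<bullet> u + v \<bullet> v) = 0" by (simp add: algebra_simps)
  have nz: "\<not> (u \<bullet> u = 0 \<and> v \<bullet> v = 0)"
  proof
    assume "u \<bullet> u = 0 \<and> v \<bullet> v = 0"
    then have "u = 0\<^sub>v n" "v = 0\<^sub>v n" using scalar_prod_self_eq_0 u v by blast+
    then have "x = 0\<^sub>v n"
      using x(1) by (intro eq_vecI) (auto simp: u_def v_def vec_eq_iff complex_eq_iff)
    with x(2) show False by simp
  qed
  have "u \<bullet> u + v \<bullet> v > 0"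
    using nz scalar_prod_self_nonneg[of u] scalar_prod_self_nonneg[of v] by auto
  with im have k: "Im k = 0" by auto
  note result = that
  have *: thesis if w: "w \<in> carrier_vec n" "w \<bullet> w \<noteq> 0" "A *\<^sub>v w = Re k \<cdot>\<^sub>v w" for w
  proof (rule result)
    let ?c = "1 / sqrt (w \<bullet> w)"
    show "?c \<cdot>\<^sub>v w \<in> carrier_vec n" using w by simp
    have "sqrt (w \<bullet> w) * sqrt (w \<bullet> w) = w \<bullet> w" using scalar_prod_self_nonneg[of w] by simp
    then show "(?c \<cdot>\<^sub>v w) \<bullet> (?c \<cdot>\<^sub>v w) = 1" using w(1,2) by simp
    show "A *\<^sub>v (?c \<cdot>\<^sub>v w) = Re k \<cdot>\<^sub>v (?c \<cdot>\<^sub>v w)"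
      using w A by (simp add: mult_mat_vec smult_smult_assoc mult.commute)
  qed
  show thesis
  proof (cases "u \<bullet> u = 0")
    case False
    have "A *\<^sub>v u = Re k \<cdot>\<^sub>v u" unfolding Au k using u v by (intro eq_vecI) auto
    with * u False show thesis by blast
  next
    case True
    have "A *\<^sub>v v = Re k \<cdot>\<^sub>v v" unfolding Av k using u v by (intro eq_vecI) auto
    with * v True nz show thesis by blast
  qed
qed

text \<open>
  The Householder reflection \<open>1 - 2 w w\<^sup>T / (w \<bullet> w)\<close> with \<open>w = v - e\<^sub>0\<close> exchanges the unit
  vectors \<open>e\<^sub>0\<close> and \<open>v\<close>. For \<open>v = e\<^sub>0\<close> the quotient is \<open>2 / 0 = 0\<close> and the formula gives the
  identity matrix, as it should.
\<close>
lemma orthonormal_mat_with_first_col: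
  fixes v :: "real vec"
  assumes v: "v \<in> carrier_vec n" and v1: "v \<bullet> v = 1" and n: "n > 0"
  obtains H where "orthonormal_mat n H" "transpose_mat H = H" "H *\<^sub>v unit_vec n 0 = v"
proof -
  define w where "w = (\<lambda>i. v $ i - (if i = 0 then 1 else 0))"
  define c where "c = (\<Sum>i<n. w i * w i)"
  define H where "H = mat n n (\<lambda>(i,j). (if i = j then 1 else 0) - 2 / c * (w i * w j))"
  have H: "H \<in> carrier_mat n n" by (simp add: H_def)
  have Ht: "transpose_mat H = H" by (rule eq_matI) (auto simp: H_def)
  have HH: "H * H = 1\<^sub>m n"
  proof (rule eq_matI)
    fix i j assume "i < dim_row (1\<^sub>m n :: real mat)" "j < dim_col (1\<^sub>m n :: real mat)"
    then have ij: "i < n" "j < n" by auto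
    have "(H * H) $$ (i,j) =
      (\<Sum>k<n. ((if i = k then 1 else 0) - 2 / c * (w i * w k)) * ((if k = j then 1 else 0) - 2 / c * (w k * w j)))"
      using ij by (simp add: H_def scalar_prod_def atLeast0LessThan)
    also have "\<dots> = (\<Sum>k<n. (if k = i then (if i = j then 1 else 0) - 2 / c * (w i * w j) else 0)
        - (if k = j then 2 / c * (w i * w j) else 0) + (2 / c)\<^sup>2 * w i * w j * (w k * w k))"
      by (intro sum.cong) (auto simp: algebra_simps power2_eq_square)
    also have "\<dots> = (if i = j then 1 else 0) - 2 / c * (w i * w j) - 2 / c * (w i * w j)
        + (2 / c)\<^sup>2 * w i * w j * c"
      using ij by (simp add: sum.distrib sum_subtractf sum.delta c_def sum_distrib_left)
    also have "\<dots> = (1\<^sub>m n) $$ (i,j)"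
      using ij by (simp add: power2_eq_square field_simps)
    finally show "(H * H) $$ (i,j) = (1\<^sub>m n) $$ (i,j)" .
  qed (use H in auto)
  have c: "c = - 2 * w 0"
  proof -
    have "c = (\<Sum>i<n. v $ i * v $ i + (if i = 0 then 1 - 2 * v $ 0 else 0))"
      unfolding c_def w_def by (intro sum.cong) (auto simp: algebra_simps)
    also have "\<dots> = v \<bullet> v + (1 - 2 * v $ 0)"
      using n v by (simp add: sum.distrib scalar_prod_def atLeast0LessThan)
    finally show ?thesis using v1 by (simp add: w_def)
  qed
  have "H *\<^sub>v unit_vec n 0 = v"
  proof (rule eq_vecI)
    fix i assume "i < dim_vec v"
    then have i: "i < n" using v by simp
    have "(H *\<^sub>v unit_vec n 0) $ i = H $$ (i, 0)"
      using i n H by simp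
    also have "\<dots> = (if i = 0 then 1 else 0) - 2 / c * w 0 * w i"
      using i n by (simp add: H_def)
    also have "\<dots> = v $ i"
    proof (cases "c = 0")
      case True
      then have "\<forall>i\<in>{..<n}. w i * w i = 0"
        unfolding c_def by (subst (asm) sum_nonneg_eq_0_iff) auto
      with i have "w i = 0" by simp
      then show ?thesis using True by (simp add: w_def)
    next
      case False
      then have "2 / c * w 0 = -1" using c by (simp add: field_simps)
      then show ?thesis by (simp add: w_def)
    qed
    finally show "(H *\<^sub>v unit_vec n 0) $ i = v $ i" .
  qed (use H v in simp)
  with H HH Ht show thesis by (intro that[of H]) (auto simp: orthonormal_mat_def)
qed

text \<open>
  Deflation: conjugating with a reflection that sends \<open>e\<^sub>0\<close> to a unit eigenvector makes the first
  column a multiple of \<open>e\<^sub>0\<close>, hence by symmetry also the first row, and the induction hypothesis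
  applies to the remaining block.
\<close>
lemma real_spectral_theorem:
  fixes A :: "real mat"
  assumes "A \<in> carrier_mat n n" and "transpose_mat A = A"
  shows "\<exists>Q d. orthonormal_mat n Q \<and> transpose_mat Q * A * Q = mat_diag n d"
  using assms
proof (induction n arbitrary: A)
  case 0
  then show ?case
    by (intro exI[of _ "1\<^sub>m 0"] exI) (auto simp: orthonormal_mat_def mat_diag_def)
next
  case (Suc n)
  note A = Suc.prems(1)
  from symmetric_real_eigenvector[OF Suc.prems] obtain e v
    where v: "v \<in> carrier_vec (Suc n)" "v \<bullet> v = 1" and Av: "A *\<^sub>v v = e \<cdot>\<^sub>v v" by blast
  from orthonormal_mat_with_first_col[OF v] obtain H
    where oH: "orthonormal_mat (Suc n) H" and Ht: "transpose_mat H = H"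
      and Hv: "H *\<^sub>v unit_vec (Suc n) 0 = v" by blast
  note H = orthonormal_matD(1)[OF oH]
  have HH: "H * H = 1\<^sub>m (Suc n)" using orthonormal_matD(2)[OF oH] Ht by simp
  define B where "B = H * A * H"
  have B: "B \<in> carrier_mat (Suc n) (Suc n)" using A H by (simp add: B_def)
  have Bt: "transpose_mat B = B"
    unfolding B_def using A H
    by (simp add: transpose_mult[of _ "Suc n" "Suc n" _ "Suc n"] Ht Suc.prems(2))
  let ?e0 = "unit_vec (Suc n) 0 :: real vec"
  have "B *\<^sub>v ?e0 = H *\<^sub>v (A *\<^sub>v (H *\<^sub>v ?e0))"
    unfolding B_def using A H
    by (simp add: mult_mat_vec_assoc)
  also have "\<dots> = e \<cdot>\<^sub>v (H *\<^sub>v (H *\<^sub>v ?e0))"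
    unfolding Hv Av using H v by (simp add: mult_mat_vec)
  also have "H *\<^sub>v (H *\<^sub>v ?e0) = (H * H) *\<^sub>v ?e0" using H by simp
  finally have Be: "B *\<^sub>v ?e0 = e \<cdot>\<^sub>v ?e0" unfolding HH by simp
  have B0: "B $$ (i, 0) = (if i = 0 then e else 0)" if "i < Suc n" for i
    using arg_cong[OF Be, of "\<lambda>x. x $ i"] that B by simp
  have B0': "B $$ (0, i) = (if i = 0 then e else 0)" if "i < Suc n" for i
  proof -
    have "B $$ (0,i) = transpose_mat B $$ (i,0)" using that B by simp
    then show ?thesis using Bt B0[OF that] by simp
  qed
  define A' where "A' = mat n n (\<lambda>(i,j). B $$ (Suc i, Suc j))"
  have A': "A' \<in> carrier_mat n n" by (simp add: A'_def)
  have A't: "transpose_mat A' = A'"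
  proof (rule eq_matI)
    fix i j assume ij: "i < dim_row A'" "j < dim_col A'"
    then have "B $$ (Suc j, Suc i) = transpose_mat B $$ (Suc i, Suc j)"
      using B A' by simp
    then show "transpose_mat A' $$ (i,j) = A' $$ (i,j)" using ij Bt by (simp add: A'_def)
  qed (auto simp: A'_def)
  have Bblock: "B = four_block_mat (mat 1 1 (\<lambda>_. e)) (0\<^sub>m 1 n) (0\<^sub>m n 1) A'"
    by (rule eq_matI) (use B in \<open>auto simp: A'_def B0 B0' not_less\<close>)
  from Suc.IH[OF A' A't] obtain Q' d where oQ': "orthonormal_mat n Q'"
    and Q'd: "transpose_mat Q' * A' * Q' = mat_diag n d" by blast
  note Q' = orthonormal_matD[OF oQ']
  define K where "K = four_block_mat (1\<^sub>m 1) (0\<^sub>m 1 n) (0\<^sub>m n 1) Q'"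
  have K: "K \<in> carrier_mat (Suc n) (Suc n)"
    using four_block_carrier_mat[OF one_carrier_mat Q'(1), of 1] by (simp add: K_def)
  have Kt: "transpose_mat K = four_block_mat (1\<^sub>m 1) (0\<^sub>m 1 n) (0\<^sub>m n 1) (transpose_mat Q')"
    unfolding K_def by (subst transpose_four_block_mat[where ?nr1.0=1 and ?nc1.0=1 and ?nr2.0=n and ?nc2.0=n])
      (use Q' in auto)
  note mfb = mult_four_block_mat[where ?nr1.0=1 and ?nc1.0=1 and ?nr2.0=n and ?nc2.0=n and ?n1.0=1 and ?n2.0=n]
  have oK: "orthonormal_mat (Suc n) K"
  proof -
    have "transpose_mat K * K = four_block_mat (1\<^sub>m 1) (0\<^sub>m 1 n) (0\<^sub>m n 1) (1\<^sub>m n)"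
      unfolding Kt unfolding K_def by (subst mfb) (use Q' in auto)
    moreover have "K * transpose_mat K = four_block_mat (1\<^sub>m 1) (0\<^sub>m 1 n) (0\<^sub>m n 1) (1\<^sub>m n)"
      unfolding Kt unfolding K_def by (subst mfb) (use Q' in auto)
    ultimately show ?thesis using K by (simp add: orthonormal_mat_def)
  qed
  define d' where "d' = (\<lambda>i. case i of 0 \<Rightarrow> e | Suc j \<Rightarrow> d j)"
  have "transpose_mat (H * K) * A * (H * K) = transpose_mat K * B * K"
    unfolding B_def using A H K by (simp add: transpose_mult[OF H K] Ht mult_mat_assoc)
  also have "\<dots> = four_block_mat (mat 1 1 (\<lambda>_. e)) (0\<^sub>m 1 n) (0\<^sub>m n 1) (mat_diag n d)"
  proof -
    have "transpose_mat K * B = four_block_mat (mat 1 1 (\<lambda>_. e)) (0\<^sub>m 1 n) (0\<^sub>m n 1) (transpose_mat Q' * A')"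
      unfolding Kt Bblock by (subst mfb) (use Q'(1) A' in auto)
    then show ?thesis
      unfolding Q'd[symmetric] unfolding K_def by (simp, subst mfb) (use Q'(1) A' in auto)
  qed
  also have "\<dots> = mat_diag (Suc n) d'"
    by (rule eq_matI) (auto simp: mat_diag_def d'_def not_less split: nat.splits)
  finally show ?case using orthonormal_mat_mult[OF oH oK] by blast
qed

section \<open>Trace inner product and Frobenius norm\<close>

lemma mat_trace_comm:
  assumes A: "A \<in> carrier_mat m n" and B: "B \<in> carrier_mat n m"
  shows "mat_trace (A * B) = mat_trace (B * A)"
proof -
  have "mat_trace (A * B) = (\<Sum>i<m. \<Sum>k<n. A $$ (i,k) * B $$ (k,i))"
    using A B by (simp add: mat_trace_def scalar_prod_def atLeast0LessThan)
  also have "\<dots> = (\<Sum>k<n. \<Sum>i<m. B $$ (k,i) * A $$ (i,k))"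
    by (subst sum.swap) (simp add: mult.commute)
  also have "\<dots> = mat_trace (B * A)"
    using A B by (simp add: mat_trace_def scalar_prod_def atLeast0LessThan)
  finally show ?thesis .
qed

lemma trace_inner_eq_sum_cols:
  assumes "A \<in> carrier_mat m n" "B \<in> carrier_mat m n"
  shows "trace_inner A B = (\<Sum>j<n. col A j \<bullet> col B j)"
  using assms by (simp add: trace_inner_def mat_trace_def)

lemma trace_inner_eq_sum:
  assumes "A \<in> carrier_mat m n" "B \<in> carrier_mat m n"
  shows "trace_inner A B = (\<Sum>i<m. \<Sum>j<n. A $$ (i,j) * B $$ (i,j))"
proof -
  have "trace_inner A B = (\<Sum>j<n. \<Sum>i<m. A $$ (i,j) * B $$ (i,j))"
    using assms by (simp add: trace_inner_eq_sum_cols scalar_prod_def atLeast0LessThan)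
  then show ?thesis by (subst sum.swap)
qed

lemma trace_inner_commute:
  "A \<in> carrier_mat m n \<Longrightarrow> B \<in> carrier_mat m n \<Longrightarrow> trace_inner A B = trace_inner B A"
  by (simp add: trace_inner_eq_sum[of _ m n] mult.commute)

lemma trace_inner_add_left:
  "A \<in> carrier_mat m n \<Longrightarrow> B \<in> carrier_mat m n \<Longrightarrow> C \<in> carrier_mat m n \<Longrightarrow>
    trace_inner (A + B) C = trace_inner A C + trace_inner B C"
  by (simp add: trace_inner_eq_sum[of _ m n] algebra_simps sum.distrib)

lemma trace_inner_add_right:
  "A \<in> carrier_mat m n \<Longrightarrow> B \<in> carrier_mat m n \<Longrightarrow> C \<in> carrier_mat m n \<Longrightarrow>
    trace_inner A (B + C) = trace_inner A B + trace_inner A C"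
  by (simp add: trace_inner_eq_sum[of _ m n] algebra_simps sum.distrib)

lemma trace_inner_diff_right:
  "A \<in> carrier_mat m n \<Longrightarrow> B \<in> carrier_mat m n \<Longrightarrow> C \<in> carrier_mat m n \<Longrightarrow>
    trace_inner A (B - C) = trace_inner A B - trace_inner A C"
  by (simp add: trace_inner_eq_sum[of _ m n] minus_carrier_mat[of C m n] algebra_simps sum_subtractf)

lemma trace_inner_smult_right:
  "A \<in> carrier_mat m n \<Longrightarrow> B \<in> carrier_mat m n \<Longrightarrow> trace_inner A (c \<cdot>\<^sub>m B) = c * trace_inner A B"
  by (simp add: trace_inner_eq_sum[of _ m n] algebra_simps sum_distrib_left)

lemma fro_norm_nonneg: "fro_norm A \<ge> 0"
  by (simp add: fro_norm_def sum_nonneg)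

lemma fro_norm_sq:
  assumes "A \<in> carrier_mat m n"
  shows "(fro_norm A)\<^sup>2 = trace_inner A A"
  using assms
  by (simp add: fro_norm_def trace_inner_eq_sum[of _ m n] sum_nonneg power2_eq_square[symmetric])

lemma fro_norm_transpose: "fro_norm (transpose_mat A) = fro_norm A"
  unfolding fro_norm_def by (subst sum.swap) simp

lemma trace_inner_mult_orthonormal:
  assumes A: "A \<in> carrier_mat m n" and B: "B \<in> carrier_mat m n" and Q: "orthonormal_mat n Q"
  shows "trace_inner (A * Q) (B * Q) = trace_inner A B"
proof -
  note q = orthonormal_matD[OF Q]
  have "trace_inner (A * Q) (B * Q) = mat_trace (transpose_mat Q * (transpose_mat A * B * Q))"
    using A B q(1) by (simp add: trace_inner_def transpose_mult_dim mult_mat_assoc)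
  also have "\<dots> = mat_trace (transpose_mat A * B * Q * transpose_mat Q)"
    by (rule mat_trace_comm[of _ n n]) (use A B q(1) in \<open>auto intro!: mult_carrier_mat\<close>)
  also have "\<dots> = trace_inner A B"
    using A B q by (simp add: trace_inner_def mult_mat_assoc)
  finally show ?thesis .
qed

lemma norm_mult_mat_vec:
  fixes A :: "real mat"
  assumes A: "A \<in> carrier_mat m n" and x: "x \<in> carrier_vec n"
  shows "(A *\<^sub>v x) \<bullet> (A *\<^sub>v x) = x \<bullet> (transpose_mat A * A *\<^sub>v x)"
proof -
  have "x \<bullet> (transpose_mat A *\<^sub>v (A *\<^sub>v x)) = (transpose_mat (transpose_mat A) *\<^sub>v x) \<bullet> (A *\<^sub>v x)"
    by (rule transpose_vec_mult_scalar[symmetric, of _ n m]) (use A x in auto)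
  then show ?thesis using A x by (simp add: mult_mat_vec_assoc)
qed

lemma norm_orthonormal_mult_vec:
  assumes Q: "orthonormal_mat n Q" and x: "x \<in> carrier_vec n"
  shows "(Q *\<^sub>v x) \<bullet> (Q *\<^sub>v x) = x \<bullet> x"
  using norm_mult_mat_vec[OF orthonormal_matD(1)[OF Q] x] orthonormal_matD(2)[OF Q] x by simp

lemma Cauchy_Schwarz_vec:
  fixes x y :: "real vec"
  assumes x: "x \<in> carrier_vec n" and y: "y \<in> carrier_vec n"
  shows "x \<bullet> y \<le> sqrt (x \<bullet> x) * sqrt (y \<bullet> y)"
proof -
  have "(x \<bullet> y)\<^sup>2 \<le> (x \<bullet> x) * (y \<bullet> y)"
  proof (cases "y \<bullet> y = 0")
    case True
    then have "y = 0\<^sub>v n" using y by (rule scalar_prod_self_eq_0[rotated])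
    then show ?thesis using x by simp
  next
    case False
    then have pos: "y \<bullet> y > 0" using scalar_prod_self_nonneg[of y] by simp
    define t where "t = (x \<bullet> y) / (y \<bullet> y)"
    have "0 \<le> (x - t \<cdot>\<^sub>v y) \<bullet> (x - t \<cdot>\<^sub>v y)" by (rule scalar_prod_self_nonneg)
    also have "\<dots> = x \<bullet> x - 2 * t * (x \<bullet> y) + t * t * (y \<bullet> y)"
      using x y comm_scalar_prod[OF x y]
      by (simp add: minus_scalar_prod_distrib[of _ n] scalar_prod_minus_distrib[of _ n] algebra_simps)
    also have "\<dots> = x \<bullet> x - (x \<bullet> y)\<^sup>2 / (y \<bullet> y)"
      using pos by (simp add: t_def field_simps power2_eq_square)
    finally show ?thesis using pos by (simp add: field_simps)
  qed
  then have "sqrt ((x \<bullet> y)\<^sup>2) \<le> sqrt ((x \<bullet> x) * (y \<bullet> y))" by (rule real_sqrt_le_mono)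
  then show ?thesis by (simp add: real_sqrt_mult)
qed

section \<open>Singular values through right singular bases\<close>

text \<open>
  \<open>Q\<close> consists of right singular vectors of \<open>A\<close>: the columns of \<open>A * Q\<close> are pairwise orthogonal
  and have the lengths \<open>s i\<close>. This half of a singular value decomposition determines all of it except for the
  left singular vectors that belong to zero singular values.
\<close>
definition svd_basis :: "nat \<Rightarrow> real mat \<Rightarrow> real mat \<Rightarrow> (nat \<Rightarrow> real) \<Rightarrow> bool" where
  "svd_basis n A Q s \<longleftrightarrow> orthonormal_mat n Q \<and> (\<forall>i<n. s i \<ge> 0) \<and>
     transpose_mat (A * Q) * (A * Q) = mat_diag n (\<lambda>i. (s i)\<^sup>2)"

lemma svd_basisD:
  assumes "svd_basis n A Q s"
  shows "orthonormal_mat n Q" "\<And>i. i < n \<Longrightarrow> s i \<ge> 0"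
    "transpose_mat (A * Q) * (A * Q) = mat_diag n (\<lambda>i. (s i)\<^sup>2)" "Q \<in> carrier_mat n n"
  using assms orthonormal_matD(1) by (auto simp: svd_basis_def)

lemma svd_basis_exists:
  assumes A: "A \<in> carrier_mat m n"
  obtains Q s where "svd_basis n A Q s"
proof -
  have "transpose_mat A * A \<in> carrier_mat n n" using A by auto
  moreover have "transpose_mat (transpose_mat A * A) = transpose_mat A * A"
    using A by (simp add: transpose_mult_dim)
  ultimately obtain Q d where Q: "orthonormal_mat n Q"
    and d: "transpose_mat Q * (transpose_mat A * A) * Q = mat_diag n d"
    using real_spectral_theorem by blast
  note q = orthonormal_matD(1)[OF Q]
  have eq: "transpose_mat (A * Q) * (A * Q) = mat_diag n d"
    unfolding d[symmetric] using A q by (simp add: transpose_mult_dim mult_mat_assoc)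
  have dnn: "d i \<ge> 0" if i: "i < n" for i
  proof -
    have "d i = (transpose_mat (A * Q) * (A * Q)) $$ (i,i)"
      unfolding eq using i by (simp add: mat_diag_def)
    also have "\<dots> = col (A * Q) i \<bullet> col (A * Q) i" using i A q by simp
    finally show ?thesis using scalar_prod_self_nonneg by simp
  qed
  have "mat_diag n d = mat_diag n (\<lambda>i. (sqrt (d i))\<^sup>2)"
    by (rule eq_matI) (auto simp: mat_diag_def dnn)
  with Q eq dnn have "svd_basis n A Q (\<lambda>i. sqrt (d i))"
    by (simp add: svd_basis_def)
  then show thesis by (rule that)
qed

lemma svd_basis_cols:
  assumes A: "A \<in> carrier_mat m n" and sb: "svd_basis n A Q s" and i: "i < n"
  shows "col (A * Q) i \<bullet> col (A * Q) i = (s i)\<^sup>2"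
proof -
  have "(transpose_mat (A * Q) * (A * Q)) $$ (i,i) = (s i)\<^sup>2"
    unfolding svd_basisD(3)[OF sb] using i by (simp add: mat_diag_def)
  then show ?thesis using i A svd_basisD(4)[OF sb] by simp
qed

text \<open>
  The Gram matrix is similar to \<open>diag (s\<^sup>2)\<close>, so the roots of its characteristic polynomial can be
  read off. Hence any right singular basis computes the nuclear and the spectral norm.
\<close>
lemma singular_values_svd_basis:
  assumes A: "A \<in> carrier_mat m n" and sb: "svd_basis n A Q s"
  shows "singular_values A = image_mset s (mset [0..<n])"
proof -
  let ?D = "mat_diag n (\<lambda>i. (s i)\<^sup>2)"
  note q = orthonormal_matD[OF svd_basisD(1)[OF sb]]
  have "transpose_mat A * A = (Q * transpose_mat Q) * (transpose_mat A * A) * (Q * transpose_mat Q)"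
    using A q by simp
  also have "\<dots> = Q * (transpose_mat (A * Q) * (A * Q)) * transpose_mat Q"
    using A q(1) by (simp add: transpose_mult_dim mult_mat_assoc)
  finally have eq: "transpose_mat A * A = Q * ?D * transpose_mat Q"
    unfolding svd_basisD(3)[OF sb] .
  have "similar_mat (transpose_mat A * A) ?D"
    by (rule similar_matI[of _ _ Q "transpose_mat Q" n]) (use A q eq in auto)
  then have "char_poly (transpose_mat A * A) = char_poly ?D" by (rule char_poly_similar)
  also have "\<dots> = (\<Prod>a\<leftarrow>diag_mat ?D. [:- a, 1:])"
    by (rule char_poly_upper_triangular[of _ n]) (auto simp: mat_diag_def)
  finally have "char_poly (transpose_mat A * A) = (\<Prod>p\<leftarrow>map (\<lambda>a. [:- a, 1:]) (diag_mat ?D). p)"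
    by simp
  then have "proots (char_poly (transpose_mat A * A)) = (\<Sum>p\<leftarrow>map (\<lambda>a. [:- a, 1:]) (diag_mat ?D). proots p)"
    by (simp only:, subst proots_prod_list) auto
  also have "\<dots> = mset (diag_mat ?D)"
  proof -
    have "(\<Sum>p\<leftarrow>map (\<lambda>a. [:- a, 1:]) xs. proots p) = mset xs" for xs :: "real list"
      by (induction xs) auto
    then show ?thesis .
  qed
  also have "diag_mat ?D = map (\<lambda>i. (s i)\<^sup>2) [0..<n]"
    by (auto simp: diag_mat_def mat_diag_def)
  finally show ?thesis
    using svd_basisD(2)[OF sb]
    by (auto simp: singular_values_def multiset.map_comp o_def intro!: image_mset_cong)
qed

lemma nuclear_norm_svd_basis:
  assumes "A \<in> carrier_mat m n" "svd_basis n A Q s"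
  shows "nuclear_norm A = (\<Sum>i<n. s i)"
  unfolding nuclear_norm_def singular_values_svd_basis[OF assms]
  by (induction n) simp_all

lemma spectral_norm_le_1_iff_svd_basis:
  assumes "A \<in> carrier_mat m n" "svd_basis n A Q s"
  shows "spectral_norm A \<le> 1 \<longleftrightarrow> (\<forall>i<n. s i \<le> 1)"
  unfolding spectral_norm_def singular_values_svd_basis[OF assms]
  by (subst Max_le_iff) auto

lemma trace_inner_self_svd_basis:
  assumes A: "A \<in> carrier_mat m n" and sb: "svd_basis n A Q s"
  shows "trace_inner A A = (\<Sum>i<n. (s i)\<^sup>2)"
proof -
  have "trace_inner A A = trace_inner (A * Q) (A * Q)"
    by (rule trace_inner_mult_orthonormal[OF A A svd_basisD(1)[OF sb], symmetric])
  also have "\<dots> = (\<Sum>i<n. (s i)\<^sup>2)"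
    using svd_basis_cols[OF A sb] A svd_basisD(4)[OF sb]
    by (subst trace_inner_eq_sum_cols[of _ m n]) (auto simp del: col_mult simp: mult_carrier_mat[of A m n])
  finally show ?thesis .
qed

definition contraction :: "nat \<Rightarrow> real mat \<Rightarrow> bool" where
  "contraction n G \<longleftrightarrow> (\<forall>x\<in>carrier_vec n. (G *\<^sub>v x) \<bullet> (G *\<^sub>v x) \<le> x \<bullet> x)"

text \<open>
  In the coordinates \<open>y = Q\<^sup>T x\<close>, the squared length of \<open>A x\<close> is the sum of the \<open>s\<^sub>i\<^sup>2 y\<^sub>i\<^sup>2\<close>.
\<close>
lemma contraction_iff_svd_basis:
  assumes A: "A \<in> carrier_mat m n" and sb: "svd_basis n A Q s"
  shows "contraction n A \<longleftrightarrow> (\<forall>i<n. s i \<le> 1)"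
proof -
  note Q = svd_basisD(1)[OF sb] and q = orthonormal_matD[OF svd_basisD(1)[OF sb]]
  have norm: "(A *\<^sub>v (Q *\<^sub>v y)) \<bullet> (A *\<^sub>v (Q *\<^sub>v y)) = (\<Sum>i<n. (s i)\<^sup>2 * (y $ i)\<^sup>2)"
    if y: "y \<in> carrier_vec n" for y
  proof -
    have AQ: "A * Q \<in> carrier_mat m n" using A q(1) by simp
    have "(A *\<^sub>v (Q *\<^sub>v y)) \<bullet> (A *\<^sub>v (Q *\<^sub>v y)) = ((A * Q) *\<^sub>v y) \<bullet> ((A * Q) *\<^sub>v y)"
      using A q(1) y by simp
    also have "\<dots> = y \<bullet> (mat_diag n (\<lambda>i. (s i)\<^sup>2) *\<^sub>v y)"
      unfolding norm_mult_mat_vec[OF AQ y] svd_basisD(3)[OF sb] ..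
    also have "mat_diag n (\<lambda>i. (s i)\<^sup>2) *\<^sub>v y = vec n (\<lambda>i. (s i)\<^sup>2 * y $ i)"
      by (rule eq_vecI) (use y in \<open>auto simp: mat_diag_def scalar_prod_def if_distrib[of "\<lambda>x. x * _"] cong: if_cong\<close>)
    also have "y \<bullet> vec n (\<lambda>i. (s i)\<^sup>2 * y $ i) = (\<Sum>i<n. (s i)\<^sup>2 * (y $ i)\<^sup>2)"
      by (simp add: scalar_prod_def atLeast0LessThan power2_eq_square algebra_simps)
    finally show ?thesis .
  qed
  show ?thesis
  proof
    assume c: "contraction n A"
    show "\<forall>i<n. s i \<le> 1"
    proof (intro allI impI)
      fix i assume i: "i < n"
      let ?e = "unit_vec n i :: real vec"
      have "(\<Sum>j<n. (s j)\<^sup>2 * (?e $ j)\<^sup>2) \<le> (Q *\<^sub>v ?e) \<bullet> (Q *\<^sub>v ?e)"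
        using c q(1) norm[of ?e] unfolding contraction_def
        by (metis mult_mat_vec_carrier unit_vec_carrier)
      also have "\<dots> = 1" using norm_orthonormal_mult_vec[OF Q, of ?e] i by simp
      also have "(\<Sum>j<n. (s j)\<^sup>2 * (?e $ j)\<^sup>2) = (\<Sum>j<n. if j = i then (s i)\<^sup>2 else 0)"
        using i by (intro sum.cong) (auto simp: unit_vec_def)
      finally have "(s i)\<^sup>2 \<le> 1" using i by simp
      then show "s i \<le> 1" by (simp add: abs_square_le_1 abs_le_iff)
    qed
  next
    assume s: "\<forall>i<n. s i \<le> 1"
    show "contraction n A"
      unfolding contraction_def
    proof
      fix x :: "real vec" assume x: "x \<in> carrier_vec n"
      define y where "y = transpose_mat Q *\<^sub>v x"
      have y: "y \<in> carrier_vec n" using q(1) x by (simp add: y_def)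
      have xy: "x = Q *\<^sub>v y"
        unfolding y_def using q x by (simp add: mult_mat_vec_assoc[symmetric])
      have "(A *\<^sub>v x) \<bullet> (A *\<^sub>v x) = (\<Sum>i<n. (s i)\<^sup>2 * (y $ i)\<^sup>2)" unfolding xy by (rule norm[OF y])
      also have "\<dots> \<le> (\<Sum>i<n. 1 * (y $ i)\<^sup>2)"
        using s svd_basisD(2)[OF sb]
        by (intro sum_mono mult_right_mono) (auto simp: abs_square_le_1)
      also have "\<dots> = y \<bullet> y" using y by (simp add: scalar_prod_def atLeast0LessThan power2_eq_square)
      also have "\<dots> = x \<bullet> x" unfolding xy by (rule norm_orthonormal_mult_vec[OF Q y, symmetric])
      finally show "(A *\<^sub>v x) \<bullet> (A *\<^sub>v x) \<le> x \<bullet> x" .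
    qed
  qed
qed

lemma spectral_norm_le_1_iff_contraction:
  assumes A: "A \<in> carrier_mat m n"
  shows "spectral_norm A \<le> 1 \<longleftrightarrow> contraction n A"
proof -
  from svd_basis_exists[OF A] obtain Q s where "svd_basis n A Q s" .
  with spectral_norm_le_1_iff_svd_basis[OF A] contraction_iff_svd_basis[OF A] show ?thesis by blast
qed

text \<open>
  The matrix that keeps the right singular vectors of \<open>A\<close> and multiplies its \<open>i\<close>-th singular
  value by \<open>c i\<close>. Two choices matter: \<open>c = 1 / s\<close> gives the partial isometry of the polar
  decomposition, and \<open>c = min 1 (1 / s)\<close> truncates the singular values at 1.
\<close>
definition rescale :: "nat \<Rightarrow> real mat \<Rightarrow> real mat \<Rightarrow> (nat \<Rightarrow> real) \<Rightarrow> real mat" where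
  "rescale n A Q c = A * Q * mat_diag n c * transpose_mat Q"

lemma
  assumes A: "A \<in> carrier_mat m n" and sb: "svd_basis n A Q s"
  shows rescale_carrier: "rescale n A Q c \<in> carrier_mat m n"
    and rescale_cols: "i < n \<Longrightarrow> col (rescale n A Q c * Q) i = c i \<cdot>\<^sub>v col (A * Q) i"
    and rescale_svd_basis: "(\<And>i. i < n \<Longrightarrow> c i \<ge> 0) \<Longrightarrow> svd_basis n (rescale n A Q c) Q (\<lambda>i. c i * s i)"
proof -
  note Q = svd_basisD(1)[OF sb] and q = orthonormal_matD[OF svd_basisD(1)[OF sb]]
  have D: "mat_diag n c \<in> carrier_mat n n" by simp
  have dims: "dim_row (mat_diag n c) = n" "dim_col (mat_diag n c) = n" by (simp_all add: mat_diag_def)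
  show "rescale n A Q c \<in> carrier_mat m n"
    using A q(1) D by (auto simp: rescale_def intro!: mult_carrier_mat)
  have eq: "rescale n A Q c * Q = A * Q * mat_diag n c"
    using A q D dims by (simp add: rescale_def mult_mat_assoc)
  show "col (rescale n A Q c * Q) i = c i \<cdot>\<^sub>v col (A * Q) i" if "i < n"
    unfolding eq
    by (subst mat_diag_mult_right[of _ m])
       (use that A q in \<open>auto simp: mult.commute simp del: col_mult intro!: eq_vecI\<close>)
  have Dt: "transpose_mat (mat_diag n c) = mat_diag n c"
    by (rule eq_matI) (auto simp: mat_diag_def)
  show "svd_basis n (rescale n A Q c) Q (\<lambda>i. c i * s i)" if c: "\<And>i. i < n \<Longrightarrow> c i \<ge> 0"
  proof -
    have "transpose_mat (rescale n A Q c * Q) * (rescale n A Q c * Q)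
        = mat_diag n c * (transpose_mat (A * Q) * (A * Q)) * mat_diag n c"
      unfolding eq using A q(1) dims Dt by (simp add: transpose_mult_dim mult_mat_assoc)
    also have "\<dots> = mat_diag n (\<lambda>i. (c i * s i)\<^sup>2)"
      unfolding svd_basisD(3)[OF sb] by (simp add: power2_eq_square mult_ac)
    finally show ?thesis using Q c svd_basisD(2)[OF sb] by (simp add: svd_basis_def)
  qed
qed

section \<open>Duality of the nuclear and the spectral norm\<close>

lemma svd_basis_norm:
  assumes A: "A \<in> carrier_mat m n" and sb: "svd_basis n A Q s" and i: "i < n"
  shows "sqrt (col (A * Q) i \<bullet> col (A * Q) i) = s i"
  unfolding svd_basis_cols[OF assms] using svd_basisD(2)[OF sb i] by simp

lemma contraction_col_le_1:
  assumes G: "G \<in> carrier_mat m n" and c: "contraction n G" and Q: "orthonormal_mat n Q" and i: "i < n"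
  shows "col (G * Q) i \<bullet> col (G * Q) i \<le> 1"
proof -
  note q = orthonormal_matD[OF Q]
  have "col (G * Q) i = G *\<^sub>v col Q i"
    by (rule eq_vecI) (use G q(1) i in auto)
  moreover have "col Q i \<bullet> col Q i = (transpose_mat Q * Q) $$ (i,i)" using q(1) i by simp
  then have "col Q i \<bullet> col Q i = 1" unfolding q(2) using i by simp
  moreover have "col Q i \<in> carrier_vec n" using q(1) i by simp
  ultimately show ?thesis using c by (metis contraction_def)
qed

text \<open>
  Evaluate the trace in a right singular basis of \<open>Z\<close>: each summand pairs a vector of length at
  most 1 with one of length \<open>s\<^sub>j\<close>.
\<close>
lemma trace_inner_le_nuclear_norm:
  assumes G: "G \<in> carrier_mat m n" and Z: "Z \<in> carrier_mat m n" and c: "contraction n G"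
  shows "trace_inner G Z \<le> nuclear_norm Z"
proof -
  from svd_basis_exists[OF Z] obtain Q s where sb: "svd_basis n Z Q s" .
  note Q = svd_basisD(1)[OF sb] and q = svd_basisD(4)[OF sb]
  have GQ: "G * Q \<in> carrier_mat m n" and ZQ: "Z * Q \<in> carrier_mat m n" using G Z q by auto
  have "trace_inner G Z = trace_inner (G * Q) (Z * Q)"
    by (rule trace_inner_mult_orthonormal[OF G Z Q, symmetric])
  also have "\<dots> = (\<Sum>j<n. col (G * Q) j \<bullet> col (Z * Q) j)"
    by (rule trace_inner_eq_sum_cols[OF GQ ZQ])
  also have "\<dots> \<le> (\<Sum>j<n. s j)"
  proof (rule sum_mono)
    fix j assume "j \<in> {..<n}"
    then have j: "j < n" by simp
    have "col (G * Q) j \<bullet> col (Z * Q) j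
        \<le> sqrt (col (G * Q) j \<bullet> col (G * Q) j) * sqrt (col (Z * Q) j \<bullet> col (Z * Q) j)"
      by (rule Cauchy_Schwarz_vec[of _ m]) (use GQ ZQ j in \<open>auto simp del: col_mult\<close>)
    also have "\<dots> \<le> 1 * s j"
      unfolding svd_basis_norm[OF Z sb j]
      by (rule mult_right_mono) (use contraction_col_le_1[OF G c Q j] svd_basisD(2)[OF sb j] in simp_all)
    finally show "col (G * Q) j \<bullet> col (Z * Q) j \<le> s j" by simp
  qed
  finally show ?thesis unfolding nuclear_norm_svd_basis[OF Z sb] .
qed

text \<open>
  The partial isometry of the polar decomposition attains the bound. Together with the previous
  lemma, the nuclear norm is a maximum of linear functionals; from here on this description
  replaces its definition through eigenvalues.
\<close>
lemma nuclear_norm_attained: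
  assumes Z: "Z \<in> carrier_mat m n"
  obtains G where "G \<in> carrier_mat m n" "contraction n G" "trace_inner G Z = nuclear_norm Z"
proof -
  from svd_basis_exists[OF Z] obtain Q s where sb: "svd_basis n Z Q s" .
  note Q = svd_basisD(1)[OF sb] and q = svd_basisD(4)[OF sb]
  define G where "G = rescale n Z Q (\<lambda>i. 1 / s i)"
  have G: "G \<in> carrier_mat m n" unfolding G_def by (rule rescale_carrier[OF Z sb])
  \<comment> \<open>A zero singular value stays zero, because then \<open>1 / s i = 0\<close>.\<close>
  have sG: "svd_basis n G Q (\<lambda>i. 1 / s i * s i)"
    unfolding G_def by (rule rescale_svd_basis[OF Z sb]) (use svd_basisD(2)[OF sb] in simp)
  have "contraction n G"
    unfolding contraction_iff_svd_basis[OF G sG] by simp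
  moreover have "trace_inner G Z = nuclear_norm Z"
  proof -
    have GQ: "G * Q \<in> carrier_mat m n" and ZQ: "Z * Q \<in> carrier_mat m n" using G Z q by auto
    have "trace_inner G Z = (\<Sum>j<n. col (G * Q) j \<bullet> col (Z * Q) j)"
      using trace_inner_mult_orthonormal[OF G Z Q] trace_inner_eq_sum_cols[OF GQ ZQ] by simp
    also have "\<dots> = (\<Sum>j<n. s j)"
    proof (rule sum.cong)
      fix j assume "j \<in> {..<n}"
      then have j: "j < n" by simp
      have c: "col (Z * Q) j \<in> carrier_vec m" by (rule col_carrier_vec[OF j ZQ])
      have "col (G * Q) j \<bullet> col (Z * Q) j = 1 / s j * (s j)\<^sup>2"
        unfolding G_def rescale_cols[OF Z sb j] svd_basis_cols[OF Z sb j, symmetric]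
        by (rule smult_scalar_prod_distrib[OF c c])
      then show "col (G * Q) j \<bullet> col (Z * Q) j = s j" by (simp add: power2_eq_square)
    qed simp
    finally show ?thesis unfolding nuclear_norm_svd_basis[OF Z sb] .
  qed
  ultimately show thesis using G that by blast
qed

lemma nuclear_norm_nonneg:
  assumes Z: "Z \<in> carrier_mat m n"
  shows "nuclear_norm Z \<ge> 0"
proof -
  from svd_basis_exists[OF Z] obtain Q s where sb: "svd_basis n Z Q s" .
  show ?thesis unfolding nuclear_norm_svd_basis[OF Z sb]
    by (rule sum_nonneg) (use svd_basisD(2)[OF sb] in simp)
qed

lemma nuclear_norm_zero: "nuclear_norm (0\<^sub>m m n) = 0"
proof -
  obtain G where G: "G \<in> carrier_mat m n" and eq: "trace_inner G (0\<^sub>m m n) = nuclear_norm (0\<^sub>m m n)"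
    by (rule nuclear_norm_attained[OF zero_carrier_mat])
  have "trace_inner G (0\<^sub>m m n) = 0" using G by (simp add: trace_inner_eq_sum[of _ m n])
  with eq show ?thesis by simp
qed

lemma nuclear_norm_combination_le:
  assumes X: "X \<in> carrier_mat m n" and Y: "Y \<in> carrier_mat m n" and "a \<ge> 0" "b \<ge> 0"
  shows "nuclear_norm (a \<cdot>\<^sub>m X + b \<cdot>\<^sub>m Y) \<le> a * nuclear_norm X + b * nuclear_norm Y"
proof -
  have XY: "a \<cdot>\<^sub>m X + b \<cdot>\<^sub>m Y \<in> carrier_mat m n" using Y by simp
  obtain G where G: "G \<in> carrier_mat m n" "contraction n G"
    and eq: "trace_inner G (a \<cdot>\<^sub>m X + b \<cdot>\<^sub>m Y) = nuclear_norm (a \<cdot>\<^sub>m X + b \<cdot>\<^sub>m Y)"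
    by (rule nuclear_norm_attained[OF XY])
  have "nuclear_norm (a \<cdot>\<^sub>m X + b \<cdot>\<^sub>m Y) = a * trace_inner G X + b * trace_inner G Y"
    unfolding eq[symmetric] using G(1) X Y
    by (simp add: trace_inner_add_right[of _ m n] trace_inner_smult_right[of _ m n])
  also have "\<dots> \<le> a * nuclear_norm X + b * nuclear_norm Y"
    using trace_inner_le_nuclear_norm[OF G(1) X G(2)] trace_inner_le_nuclear_norm[OF G(1) Y G(2)] assms(3,4)
    by (intro add_mono mult_left_mono)
  finally show ?thesis .
qed

lemma mat_convex_nuclear_norm: "mat_convex_fun m n nuclear_norm"
  unfolding mat_convex_fun_def by (auto intro!: nuclear_norm_combination_le)

lemma fro_norm_le_nuclear_norm:
  assumes Z: "Z \<in> carrier_mat m n"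
  shows "fro_norm Z \<le> nuclear_norm Z"
proof (rule power2_le_imp_le[OF _ nuclear_norm_nonneg[OF Z]])
  from svd_basis_exists[OF Z] obtain Q s where sb: "svd_basis n Z Q s" .
  have "(fro_norm Z)\<^sup>2 = (\<Sum>i<n. (s i)\<^sup>2)"
    unfolding fro_norm_sq[OF Z] by (rule trace_inner_self_svd_basis[OF Z sb])
  also have "\<dots> \<le> (\<Sum>i<n. s i * (\<Sum>j<n. s j))"
    unfolding power2_eq_square
    by (intro sum_mono mult_left_mono member_le_sum) (use svd_basisD(2)[OF sb] in auto)
  also have "\<dots> = (nuclear_norm Z)\<^sup>2"
    unfolding nuclear_norm_svd_basis[OF Z sb] by (simp add: sum_distrib_right power2_eq_square)
  finally show "(fro_norm Z)\<^sup>2 \<le> (nuclear_norm Z)\<^sup>2" .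
qed

lemma trace_inner_le_fro_norm:
  assumes A: "A \<in> carrier_mat m n" and B: "B \<in> carrier_mat m n"
  shows "trace_inner A B \<le> fro_norm A * fro_norm B"
proof (cases "trace_inner B B = 0")
  case True
  then have "\<forall>i\<in>{..<m}. (\<Sum>j<n. B $$ (i,j) * B $$ (i,j)) = 0"
    using B by (subst sum_nonneg_eq_0_iff[symmetric]) (auto simp: trace_inner_eq_sum[of _ m n] sum_nonneg)
  then have "\<forall>i\<in>{..<m}. \<forall>j\<in>{..<n}. B $$ (i,j) * B $$ (i,j) = 0"
    by (subst (asm) sum_nonneg_eq_0_iff) auto
  then have "trace_inner A B = 0" using A B by (simp add: trace_inner_eq_sum[of _ m n])
  then show ?thesis by (simp add: fro_norm_nonneg)
next
  case False
  let ?b = "trace_inner B B" and ?ab = "trace_inner A B"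
  have bpos: "?b > 0" using False fro_norm_sq[OF B] zero_le_power2[of "fro_norm B"] by simp
  define C where "C = A - (?ab / ?b) \<cdot>\<^sub>m B"
  have C: "C \<in> carrier_mat m n" using B by (simp add: C_def minus_carrier_mat)
  have "0 \<le> trace_inner C C" using fro_norm_sq[OF C] zero_le_power2[of "fro_norm C"] by simp
  also have "\<dots> = trace_inner C A - ?ab / ?b * trace_inner C B"
    using A B C unfolding C_def[symmetric]
    by (subst (2) C_def) (simp add: trace_inner_diff_right[of _ m n] trace_inner_smult_right[of _ m n])
  also have "trace_inner C A = trace_inner A A - ?ab / ?b * ?ab"
    using A B C unfolding trace_inner_commute[OF C A] unfolding C_def
    by (simp add: trace_inner_diff_right[of _ m n] trace_inner_smult_right[of _ m n])
  also have "trace_inner C B = ?ab - ?ab / ?b * ?b"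
    using A B C unfolding trace_inner_commute[OF C B] unfolding C_def
    by (simp add: trace_inner_diff_right[of _ m n] trace_inner_smult_right[of _ m n] trace_inner_commute[of B m n A])
  finally have "?ab\<^sup>2 \<le> trace_inner A A * ?b"
    using bpos by (simp add: field_simps power2_eq_square)
  then have "?ab\<^sup>2 \<le> (fro_norm A * fro_norm B)\<^sup>2"
    by (simp add: fro_norm_sq[OF A] fro_norm_sq[OF B] power_mult_distrib)
  then show ?thesis by (rule power2_le_imp_le) (simp add: fro_norm_nonneg)
qed

lemma fro_norm_diff_triangle:
  assumes A: "A \<in> carrier_mat m n" and B: "B \<in> carrier_mat m n"
  shows "fro_norm (A - B) \<le> fro_norm A + fro_norm B"
proof (rule power2_le_imp_le)
  have AB: "A - B \<in> carrier_mat m n" using B by (rule minus_carrier_mat)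
  have "(fro_norm (A - B))\<^sup>2 = trace_inner (A - B) A - trace_inner (A - B) B"
    unfolding fro_norm_sq[OF AB] by (rule trace_inner_diff_right[OF AB A B])
  also have "\<dots> = trace_inner A A - 2 * trace_inner A B + trace_inner B B"
    using trace_inner_diff_right[OF A A B] trace_inner_diff_right[OF B A B]
      trace_inner_commute[OF AB A] trace_inner_commute[OF AB B] trace_inner_commute[OF A B] by simp
  also have "trace_inner A B = - trace_inner A ((-1) \<cdot>\<^sub>m B)"
    using A B by (simp add: trace_inner_smult_right[of _ m n])
  also have "trace_inner A ((-1) \<cdot>\<^sub>m B) \<le> fro_norm A * fro_norm ((-1) \<cdot>\<^sub>m B)"
    using A B by (intro trace_inner_le_fro_norm) auto
  also have "fro_norm ((-1) \<cdot>\<^sub>m B) = fro_norm B"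
    by (simp add: fro_norm_def)
  finally show "(fro_norm (A - B))\<^sup>2 \<le> (fro_norm A + fro_norm B)\<^sup>2"
    by (simp add: fro_norm_sq[OF A, symmetric] fro_norm_sq[OF B, symmetric] power2_eq_square algebra_simps)
qed (simp add: fro_norm_nonneg)

text \<open>
  The minimum is attained at the matrix with truncated singular values. Column by column in the basis \<open>Q\<close>, a column of \<open>V * Q\<close> with length at most 1 has
  distance at least \<open>max 0 (s\<^sub>j - 1)\<close> from the column of \<open>M * Q\<close> with length \<open>s\<^sub>j\<close>, and
  truncation gives equality in all columns simultaneously.
\<close>
lemma spectral_ball_projection:
  assumes M: "M \<in> carrier_mat p q"
  shows "\<exists>w. is_min_value (\<lambda>W. (fro_norm (M - W))\<^sup>2) {W \<in> carrier_mat p q. spectral_norm W \<le> 1} w"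
proof -
  from svd_basis_exists[OF M] obtain Q s where sb: "svd_basis q M Q s" .
  note Q = svd_basisD(1)[OF sb] and Qc = svd_basisD(4)[OF sb]
  let ?w = "\<Sum>j<q. (max 0 (s j - 1))\<^sup>2"
  define c where "c = (\<lambda>i. min 1 (1 / s i))"
  define W where "W = rescale q M Q c"
  have W: "W \<in> carrier_mat p q" unfolding W_def by (rule rescale_carrier[OF M sb])
  have cs: "c j * s j = min 1 (s j)" "c j \<ge> 0" if "j < q" for j
    using svd_basisD(2)[OF sb that] by (cases "s j = 0"; auto simp: c_def min_def field_simps)+
  have sW: "svd_basis q W Q (\<lambda>i. c i * s i)"
    unfolding W_def by (rule rescale_svd_basis[OF M sb cs(2)])
  have Wmem: "spectral_norm W \<le> 1"
    unfolding spectral_norm_le_1_iff_svd_basis[OF W sW] by (simp add: cs)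
  have MQ: "M * Q \<in> carrier_mat p q" using M Qc by simp
  have diff: "(fro_norm (M - V))\<^sup>2
      = (\<Sum>j<q. (s j)\<^sup>2 - 2 * (col (M * Q) j \<bullet> col (V * Q) j) + col (V * Q) j \<bullet> col (V * Q) j)"
    if V: "V \<in> carrier_mat p q" for V
  proof -
    have MV: "M - V \<in> carrier_mat p q" using V by (rule minus_carrier_mat)
    have VQ: "V * Q \<in> carrier_mat p q" using V Qc by simp
    have "(fro_norm (M - V))\<^sup>2 = trace_inner M M - 2 * trace_inner M V + trace_inner V V"
      unfolding fro_norm_sq[OF MV]
      using trace_inner_diff_right[OF MV M V] trace_inner_diff_right[OF M M V] trace_inner_diff_right[OF V M V]
        trace_inner_commute[OF MV M] trace_inner_commute[OF MV V] trace_inner_commute[OF M V] by simp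
    also have "\<dots> = trace_inner (M * Q) (M * Q) - 2 * trace_inner (M * Q) (V * Q) + trace_inner (V * Q) (V * Q)"
      by (simp add: trace_inner_mult_orthonormal[OF _ _ Q, of _ p] M V)
    also have "\<dots> = (\<Sum>j<q. (s j)\<^sup>2 - 2 * (col (M * Q) j \<bullet> col (V * Q) j) + col (V * Q) j \<bullet> col (V * Q) j)"
      unfolding trace_inner_eq_sum_cols[OF MQ MQ] trace_inner_eq_sum_cols[OF MQ VQ] trace_inner_eq_sum_cols[OF VQ VQ]
      by (simp add: sum.distrib sum_subtractf sum_distrib_left svd_basis_cols[OF M sb] del: col_mult)
    finally show ?thesis .
  qed
  show ?thesis
    unfolding is_min_value_def
  proof (intro exI[of _ ?w] conjI ballI)
    have "(fro_norm (M - W))\<^sup>2 = ?w"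
      unfolding diff[OF W]
    proof (rule sum.cong)
      fix j assume "j \<in> {..<q}"
      then have j: "j < q" by simp
      have cM: "col (M * Q) j \<in> carrier_vec p" by (rule col_carrier_vec[OF j MQ])
      have mw: "col (M * Q) j \<bullet> col (W * Q) j = c j * (s j)\<^sup>2"
        unfolding W_def rescale_cols[OF M sb j] svd_basis_cols[OF M sb j, symmetric]
        by (rule scalar_prod_smult_distrib[OF cM cM])
      show "(s j)\<^sup>2 - 2 * (col (M * Q) j \<bullet> col (W * Q) j) + col (W * Q) j \<bullet> col (W * Q) j
          = (max 0 (s j - 1))\<^sup>2"
      proof -
        have "(s j)\<^sup>2 - 2 * (col (M * Q) j \<bullet> col (W * Q) j) + col (W * Q) j \<bullet> col (W * Q) j = (s j - c j * s j)\<^sup>2"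
          unfolding mw svd_basis_cols[OF W sW j] by (simp add: power2_eq_square algebra_simps)
        also have "s j - c j * s j = max 0 (s j - 1)" using cs(1)[OF j] by (simp add: min_def max_def)
        finally show ?thesis .
      qed
    qed simp
    with W Wmem show "\<exists>W\<in>{W \<in> carrier_mat p q. spectral_norm W \<le> 1}. (fro_norm (M - W))\<^sup>2 = ?w" by blast
  next
    fix V assume "V \<in> {W \<in> carrier_mat p q. spectral_norm W \<le> 1}"
    then have V: "V \<in> carrier_mat p q" and cV: "contraction q V"
      using spectral_norm_le_1_iff_contraction by auto
    have VQ: "V * Q \<in> carrier_mat p q" using V Qc by simp
    show "?w \<le> (fro_norm (M - V))\<^sup>2"
      unfolding diff[OF V]
    proof (rule sum_mono)
      fix j assume "j \<in> {..<q}"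
      then have j: "j < q" by simp
      let ?b = "sqrt (col (V * Q) j \<bullet> col (V * Q) j)"
      have b: "?b \<le> 1" "0 \<le> ?b" and b2: "?b\<^sup>2 = col (V * Q) j \<bullet> col (V * Q) j"
        using contraction_col_le_1[OF V cV Q j] scalar_prod_self_nonneg[of "col (V * Q) j"]
        by (simp_all del: col_mult)
      have "col (M * Q) j \<bullet> col (V * Q) j \<le> s j * ?b"
        unfolding svd_basis_norm[OF M sb j, symmetric]
        by (rule Cauchy_Schwarz_vec[of _ p]) (rule col_carrier_vec[OF j MQ] col_carrier_vec[OF j VQ])+
      then have "(s j - ?b)\<^sup>2 \<le> (s j)\<^sup>2 - 2 * (col (M * Q) j \<bullet> col (V * Q) j) + ?b\<^sup>2"
        by (simp add: power2_diff del: col_mult real_sqrt_pow2_iff)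
      moreover have "(max 0 (s j - 1))\<^sup>2 \<le> (s j - ?b)\<^sup>2"
      proof (cases "s j \<le> 1")
        case False
        with b show ?thesis by (intro power_mono) auto
      qed simp
      ultimately show "(max 0 (s j - 1))\<^sup>2
          \<le> (s j)\<^sup>2 - 2 * (col (M * Q) j \<bullet> col (V * Q) j) + col (V * Q) j \<bullet> col (V * Q) j"
        unfolding b2 by linarith
    qed
  qed
qed

section \<open>A sandwich theorem and the sum rule for subdifferentials\<close>

text \<open>
  The one-dimensional extension step of a Hahn-Banach argument for two convex functions. The
  linear functional with the coefficients \<open>A\<close> bounds \<open>g X + h Y\<close> from below as long as \<open>X - Y\<close>
  is supported in \<open>S\<close>; a coefficient \<open>c\<close> for one more entry \<open>p\<close> is sought. The pairs
  with \<open>X $$ p > Y $$ p\<close> bound \<open>c\<close> from above by \<open>slope\<close>, those with \<open>X $$ p < Y $$ p\<close> bound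
  it from below. Any lower bound is below any upper bound, because a suitable convex combination
  of two such pairs agrees at \<open>p\<close>, where the hypothesis applies.
\<close>
lemma sandwich_step:
  fixes g h :: "real mat \<Rightarrow> real" and A :: "nat \<times> nat \<Rightarrow> real"
  assumes g: "mat_convex_fun m n g" and h: "mat_convex_fun m n h"
    and S: "S \<subseteq> {..<m} \<times> {..<n}" and p: "p \<notin> S" "fst p < m" "snd p < n"
    and A: "\<And>X Y. X \<in> carrier_mat m n \<Longrightarrow> Y \<in> carrier_mat m n \<Longrightarrow>
      (\<And>i j. i < m \<Longrightarrow> j < n \<Longrightarrow> (i,j) \<notin> S \<Longrightarrow> X $$ (i,j) = Y $$ (i,j)) \<Longrightarrow>
      (\<Sum>r\<in>S. A r * (X $$ r - Y $$ r)) \<le> g X + h Y"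
  shows "\<exists>c. \<forall>X\<in>carrier_mat m n. \<forall>Y\<in>carrier_mat m n.
      (\<forall>i<m. \<forall>j<n. (i,j) \<notin> insert p S \<longrightarrow> X $$ (i,j) = Y $$ (i,j)) \<longrightarrow>
      (\<Sum>r\<in>S. A r * (X $$ r - Y $$ r)) + c * (X $$ p - Y $$ p) \<le> g X + h Y"
proof -
  define adm where "adm = (\<lambda>(X :: real mat) (Y :: real mat). X \<in> carrier_mat m n \<and> Y \<in> carrier_mat m n \<and>
      (\<forall>i<m. \<forall>j<n. (i,j) \<notin> insert p S \<longrightarrow> X $$ (i,j) = Y $$ (i,j)))"
  define f where "f = (\<lambda>X Y. \<Sum>r\<in>S. A r * (X $$ r - Y $$ r))"
  define slope where "slope = (\<lambda>(X, Y). (g X + h Y - f X Y) / (X $$ p - Y $$ p))"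
  define pos where "pos = {(X, Y). adm X Y \<and> X $$ p > Y $$ p}"
  define neg where "neg = {(X, Y). adm X Y \<and> X $$ p < Y $$ p}"
  have key: "slope (X', Y') \<le> slope (X, Y)" if XY: "(X, Y) \<in> pos" and XY': "(X', Y') \<in> neg" for X Y X' Y'
  proof -
    define a where "a = X $$ p - Y $$ p"
    define b where "b = Y' $$ p - X' $$ p"
    have a: "a > 0" and b: "b > 0" using XY XY' by (auto simp: pos_def neg_def a_def b_def)
    have c: "X \<in> carrier_mat m n" "Y \<in> carrier_mat m n" "X' \<in> carrier_mat m n" "Y' \<in> carrier_mat m n"
      using XY XY' by (auto simp: pos_def neg_def adm_def)
    \<comment> \<open>The weight for which the differences \<open>a\<close> and \<open>- b\<close> at the entry \<open>p\<close> cancel.\<close>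
    define t where "t = b / (a + b)"
    have t: "0 \<le> t" "t \<le> 1" "1 - t = a / (a + b)" using a b by (auto simp: t_def field_simps)
    define X0 where "X0 = (1 - t) \<cdot>\<^sub>m X' + t \<cdot>\<^sub>m X"
    define Y0 where "Y0 = (1 - t) \<cdot>\<^sub>m Y' + t \<cdot>\<^sub>m Y"
    have c0: "X0 \<in> carrier_mat m n" "Y0 \<in> carrier_mat m n" using c by (auto simp: X0_def Y0_def)
    have e: "X0 $$ (i,j) = (1 - t) * X' $$ (i,j) + t * X $$ (i,j)"
      "Y0 $$ (i,j) = (1 - t) * Y' $$ (i,j) + t * Y $$ (i,j)" if "i < m" "j < n" for i j
      using that c by (auto simp: X0_def Y0_def)
    have ep: "X0 $$ p = (1 - t) * X' $$ p + t * X $$ p" "Y0 $$ p = (1 - t) * Y' $$ p + t * Y $$ p"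
      using e[OF p(2,3)] by simp_all
    have "X0 $$ p - Y0 $$ p = t * a - (1 - t) * b" unfolding ep a_def b_def by (simp add: algebra_simps)
    also have "\<dots> = 0" unfolding t(3) using a b by (simp add: t_def)
    finally have p0: "X0 $$ p = Y0 $$ p" by simp
    have Se: "X0 $$ r - Y0 $$ r = (1 - t) * (X' $$ r - Y' $$ r) + t * (X $$ r - Y $$ r)" if "r \<in> S" for r
      using that S by (cases r) (auto simp: e algebra_simps)
    have "f X0 Y0 \<le> g X0 + h Y0"
      unfolding f_def
    proof (rule A[OF c0])
      fix i j assume ij: "i < m" "j < n" "(i,j) \<notin> S"
      show "X0 $$ (i,j) = Y0 $$ (i,j)"
      proof (cases "(i,j) = p")
        case False
        with ij XY XY' have "X $$ (i,j) = Y $$ (i,j)" "X' $$ (i,j) = Y' $$ (i,j)"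
          by (auto simp: pos_def neg_def adm_def)
        then show ?thesis using e[OF ij(1,2)] by simp
      qed (use p0 in simp)
    qed
    also have "g X0 + h Y0 \<le> ((1 - t) * g X' + t * g X) + ((1 - t) * h Y' + t * h Y)"
      using g h c t(1,2) unfolding mat_convex_fun_def X0_def Y0_def by (intro add_mono) auto
    also have "f X0 Y0 = (1 - t) * f X' Y' + t * f X Y"
      unfolding f_def sum_distrib_left sum.distrib[symmetric]
      by (rule sum.cong) (simp_all add: Se algebra_simps)
    finally have "0 \<le> (1 - t) * (g X' + h Y' - f X' Y') + t * (g X + h Y - f X Y)"
      by (simp add: algebra_simps)
    also have "\<dots> = (a * (g X' + h Y' - f X' Y') + b * (g X + h Y - f X Y)) / (a + b)"
      unfolding t(3) by (simp add: t_def add_divide_distrib)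
    finally have "0 \<le> a * (g X' + h Y' - f X' Y') + b * (g X + h Y - f X Y)"
      using a b by (simp add: zero_le_divide_iff)
    then have "- (g X' + h Y' - f X' Y') / b \<le> (g X + h Y - f X Y) / a"
      using a b by (simp add: field_simps)
    moreover have "slope (X', Y') = - (g X' + h Y' - f X' Y') / b"
      using b by (simp add: slope_def b_def field_simps)
    ultimately show ?thesis by (simp add: slope_def a_def)
  qed
  let ?E = "mat m n (\<lambda>r. if r = p then 1 else 0) :: real mat"
  \<comment> \<open>The supremum below is taken over a nonempty set that is bounded above.\<close>
  have pE: "(?E, 0\<^sub>m m n) \<in> pos" and nE: "(0\<^sub>m m n, ?E) \<in> neg"
    using p(2,3) by (cases p; auto simp: pos_def neg_def adm_def)+
  define c where "c = Sup (slope ` neg)"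
  have up: "slope z \<le> c" if "z \<in> neg" for z
    unfolding c_def by (rule cSup_upper) (use that key pE in \<open>auto intro!: bdd_aboveI[of _ "slope (?E, 0\<^sub>m m n)"]\<close>)
  have low: "c \<le> slope z" if "z \<in> pos" for z
    unfolding c_def by (rule cSup_least) (use that nE key in \<open>(cases z; auto)+\<close>)
  show ?thesis
  proof (intro exI[of _ c] ballI impI)
    fix X Y :: "real mat" assume "X \<in> carrier_mat m n" "Y \<in> carrier_mat m n"
      "\<forall>i<m. \<forall>j<n. (i,j) \<notin> insert p S \<longrightarrow> X $$ (i,j) = Y $$ (i,j)"
    then have adm: "adm X Y" by (simp add: adm_def)
    consider "X $$ p > Y $$ p" | "X $$ p < Y $$ p" | "X $$ p = Y $$ p" by linarith
    then have "f X Y + c * (X $$ p - Y $$ p) \<le> g X + h Y"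
    proof cases
      case 1
      with low[of "(X, Y)"] adm show ?thesis by (simp add: pos_def slope_def field_simps)
    next
      case 2
      with up[of "(X, Y)"] adm show ?thesis by (simp add: neg_def slope_def field_simps)
    next
      case 3
      have "f X Y \<le> g X + h Y"
        unfolding f_def by (rule A) (use adm 3 in \<open>auto simp: adm_def\<close>)
      with 3 show ?thesis by simp
    qed
    then show "(\<Sum>r\<in>S. A r * (X $$ r - Y $$ r)) + c * (X $$ p - Y $$ p) \<le> g X + h Y"
      by (simp add: f_def)
  qed
qed

text \<open>
  The conclusion for pairs \<open>X\<close>, \<open>Y\<close> is stronger than separating \<open>g\<close> from \<open>- h\<close>, and this form is
  what makes the induction over the entries go through. Without any entry it says
  \<open>0 \<le> g X + h X\<close>.
\<close>
lemma sandwich_linear: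
  fixes g h :: "real mat \<Rightarrow> real"
  assumes g: "mat_convex_fun m n g" and h: "mat_convex_fun m n h"
    and nonneg: "\<And>X. X \<in> carrier_mat m n \<Longrightarrow> 0 \<le> g X + h X"
  obtains G where "G \<in> carrier_mat m n"
    "\<And>X Y. X \<in> carrier_mat m n \<Longrightarrow> Y \<in> carrier_mat m n \<Longrightarrow> trace_inner G (X - Y) \<le> g X + h Y"
proof -
  let ?I = "{..<m} \<times> {..<n}"
  have fin: "finite ?I" by simp
  have ext: "S \<subseteq> ?I \<Longrightarrow> \<exists>A. \<forall>X\<in>carrier_mat m n. \<forall>Y\<in>carrier_mat m n.
      (\<forall>i<m. \<forall>j<n. (i,j) \<notin> S \<longrightarrow> X $$ (i,j) = Y $$ (i,j)) \<longrightarrow>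
      (\<Sum>r\<in>S. A r * (X $$ r - Y $$ r)) \<le> g X + h Y" if "finite S" for S :: "(nat \<times> nat) set"
    using that
  proof (induction S rule: finite_induct)
    case empty
    show ?case
    proof (intro exI ballI impI)
      fix X Y :: "real mat"
      assume XY: "X \<in> carrier_mat m n" "Y \<in> carrier_mat m n"
        "\<forall>i<m. \<forall>j<n. (i,j) \<notin> {} \<longrightarrow> X $$ (i,j) = Y $$ (i,j)"
      then have "X = Y" by (intro eq_matI) auto
      with nonneg[OF XY(1)] show "(\<Sum>r\<in>{}. undefined r * (X $$ r - Y $$ r)) \<le> g X + h Y" by simp
    qed
  next
    case (insert p S)
    then obtain A where A: "\<forall>X\<in>carrier_mat m n. \<forall>Y\<in>carrier_mat m n.
      (\<forall>i<m. \<forall>j<n. (i,j) \<notin> S \<longrightarrow> X $$ (i,j) = Y $$ (i,j)) \<longrightarrow>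
      (\<Sum>r\<in>S. A r * (X $$ r - Y $$ r)) \<le> g X + h Y" by auto
    have "\<exists>c. \<forall>X\<in>carrier_mat m n. \<forall>Y\<in>carrier_mat m n.
      (\<forall>i<m. \<forall>j<n. (i,j) \<notin> insert p S \<longrightarrow> X $$ (i,j) = Y $$ (i,j)) \<longrightarrow>
      (\<Sum>r\<in>S. A r * (X $$ r - Y $$ r)) + c * (X $$ p - Y $$ p) \<le> g X + h Y"
      by (rule sandwich_step[OF g h]) (use insert A in \<open>auto simp: mem_Times_iff\<close>)
    then obtain c where c: "\<forall>X\<in>carrier_mat m n. \<forall>Y\<in>carrier_mat m n.
      (\<forall>i<m. \<forall>j<n. (i,j) \<notin> insert p S \<longrightarrow> X $$ (i,j) = Y $$ (i,j)) \<longrightarrow>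
      (\<Sum>r\<in>S. A r * (X $$ r - Y $$ r)) + c * (X $$ p - Y $$ p) \<le> g X + h Y" by blast
    have "(\<Sum>r\<in>insert p S. (A(p := c)) r * (X $$ r - Y $$ r))
        = (\<Sum>r\<in>S. A r * (X $$ r - Y $$ r)) + c * (X $$ p - Y $$ p)" for X Y :: "real mat"
    proof -
      have "(\<Sum>r\<in>S. (A(p := c)) r * (X $$ r - Y $$ r)) = (\<Sum>r\<in>S. A r * (X $$ r - Y $$ r))"
        using insert.hyps(2) by (intro sum.cong) auto
      then show ?thesis using insert.hyps by simp
    qed
    with c show ?case by (intro exI[of _ "A(p := c)"]) simp
  qed
  from ext[OF fin subset_refl] obtain A where A: "\<And>X Y. X \<in> carrier_mat m n \<Longrightarrow> Y \<in> carrier_mat m n \<Longrightarrow>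
      (\<Sum>r\<in>?I. A r * (X $$ r - Y $$ r)) \<le> g X + h Y" by fastforce
  show thesis
  proof (rule that[of "mat m n A"])
    fix X Y :: "real mat" assume XY: "X \<in> carrier_mat m n" "Y \<in> carrier_mat m n"
    then have "trace_inner (mat m n A) (X - Y) = (\<Sum>r\<in>?I. A r * (X $$ r - Y $$ r))"
      by (subst trace_inner_eq_sum[of _ m n]) (auto simp: sum.cartesian_product minus_carrier_mat intro!: sum.cong)
    with A[OF XY] show "trace_inner (mat m n A) (X - Y) \<le> g X + h Y" by simp
  qed simp
qed

lemma subdifferentialD:
  assumes "G \<in> subdifferential m n f L"
  shows "G \<in> carrier_mat m n" "\<And>Z. Z \<in> carrier_mat m n \<Longrightarrow> f L + trace_inner G (Z - L) \<le> f Z"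
  using assms by (auto simp: subdifferential_def)

text \<open>
  For a subgradient \<open>E\<close> of the sum, the functions \<open>f - f L\<close> and \<open>g - g L - \<langle>E, \<cdot> - L\<rangle>\<close> have a
  nonnegative sum. The linear functional \<open>G\<close> from the sandwich theorem splits \<open>E\<close> as
  \<open>G + (E - G)\<close>: setting one of its two arguments to \<open>L\<close> yields each of the subgradient
  inequalities.
\<close>
lemma subdifferential_sum_rule:
  assumes f: "mat_convex_fun m n f" and g: "mat_convex_fun m n g" and L: "L \<in> carrier_mat m n"
  shows "subdifferential m n f L + subdifferential m n g L = subdifferential m n (\<lambda>X. f X + g X) L"
proof
  show "subdifferential m n f L + subdifferential m n g L \<subseteq> subdifferential m n (\<lambda>X. f X + g X) L"
  proof
    fix E assume "E \<in> subdifferential m n f L + subdifferential m n g L"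
    then obtain G H where E: "E = G + H" and G: "G \<in> subdifferential m n f L" and H: "H \<in> subdifferential m n g L"
      by (auto simp: set_plus_def)
    note G' = subdifferentialD[OF G] and H' = subdifferentialD[OF H]
    show "E \<in> subdifferential m n (\<lambda>X. f X + g X) L"
      unfolding subdifferential_def
    proof (intro CollectI conjI ballI)
      show "E \<in> carrier_mat m n" unfolding E using H'(1) by simp
      fix Z :: "real mat" assume Z: "Z \<in> carrier_mat m n"
      have "Z - L \<in> carrier_mat m n" using L by (rule minus_carrier_mat)
      then have "trace_inner E (Z - L) = trace_inner G (Z - L) + trace_inner H (Z - L)"
        unfolding E using G'(1) H'(1) by (intro trace_inner_add_left)
      with G'(2)[OF Z] H'(2)[OF Z] show "f Z + g Z \<ge> f L + g L + trace_inner E (Z - L)" by linarith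
    qed
  qed
next
  show "subdifferential m n (\<lambda>X. f X + g X) L \<subseteq> subdifferential m n f L + subdifferential m n g L"
  proof
    fix E assume "E \<in> subdifferential m n (\<lambda>X. f X + g X) L"
    note E = subdifferentialD[OF this]
    have diff: "trace_inner A (X - Y) = trace_inner A X - trace_inner A Y"
      if "A \<in> carrier_mat m n" "X \<in> carrier_mat m n" "Y \<in> carrier_mat m n" for A X Y
      using that by (rule trace_inner_diff_right)
    define f' where "f' = (\<lambda>X. f X - f L)"
    define g' where "g' = (\<lambda>X. g X - g L - (trace_inner E X - trace_inner E L))"
    have f'c: "mat_convex_fun m n f'"
      using f by (fastforce simp: mat_convex_fun_def f'_def algebra_simps)
    have g'c: "mat_convex_fun m n g'"
      unfolding mat_convex_fun_def
    proof (intro ballI allI impI)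
      fix X Y :: "real mat" and t :: real
      assume XY: "X \<in> carrier_mat m n" "Y \<in> carrier_mat m n" and t: "0 \<le> t \<and> t \<le> 1"
      have "g ((1 - t) \<cdot>\<^sub>m X + t \<cdot>\<^sub>m Y) \<le> (1 - t) * g X + t * g Y"
        using g XY t by (auto simp: mat_convex_fun_def)
      moreover have "trace_inner E ((1 - t) \<cdot>\<^sub>m X + t \<cdot>\<^sub>m Y) = (1 - t) * trace_inner E X + t * trace_inner E Y"
        using E(1) XY by (simp add: trace_inner_add_right[of _ m n] trace_inner_smult_right[of _ m n])
      ultimately show "g' ((1 - t) \<cdot>\<^sub>m X + t \<cdot>\<^sub>m Y) \<le> (1 - t) * g' X + t * g' Y"
        by (simp add: g'_def algebra_simps)
    qed
    have nn: "0 \<le> f' X + g' X" if X: "X \<in> carrier_mat m n" for X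
      using E(2)[OF X] diff[OF E(1) X L] by (simp add: f'_def g'_def)
    obtain G where G: "G \<in> carrier_mat m n"
      and GXY: "\<And>X Y. X \<in> carrier_mat m n \<Longrightarrow> Y \<in> carrier_mat m n \<Longrightarrow> trace_inner G (X - Y) \<le> f' X + g' Y"
      using sandwich_linear[OF f'c g'c nn] by blast
    have "G \<in> subdifferential m n f L"
      using G GXY[OF _ L] by (auto simp: subdifferential_def f'_def g'_def algebra_simps)
    moreover have "E - G \<in> subdifferential m n g L"
      unfolding subdifferential_def
    proof (intro CollectI conjI ballI)
      show EG: "E - G \<in> carrier_mat m n" using G by (rule minus_carrier_mat)
      fix Z :: "real mat" assume Z: "Z \<in> carrier_mat m n"
      have ZL: "Z - L \<in> carrier_mat m n" using L by (rule minus_carrier_mat)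
      have "trace_inner (E - G) (Z - L) = trace_inner E (Z - L) - trace_inner G (Z - L)"
        unfolding trace_inner_commute[OF EG ZL] trace_inner_commute[OF E(1) ZL] trace_inner_commute[OF G ZL]
        by (rule diff[OF ZL E(1) G])
      with GXY[OF L Z] show "g Z \<ge> g L + trace_inner (E - G) (Z - L)"
        by (simp add: f'_def g'_def diff[OF E(1) Z L] diff[OF G Z L] diff[OF G L Z])
    qed
    moreover have "E = G + (E - G)" using E(1) G by (intro eq_matI) auto
    ultimately show "E \<in> subdifferential m n f L + subdifferential m n g L"
      by (metis set_plus_intro)
  qed
qed

section \<open>Orthonormal splittings and the full singular value decomposition\<close>

text \<open>
  The matrix with the column blocks \<open>P1\<close>, \<open>P2\<close> is orthogonal, expressed through the blocks alone.
\<close>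
definition orthonormal_split :: "nat \<Rightarrow> nat \<Rightarrow> real mat \<Rightarrow> real mat \<Rightarrow> bool" where
  "orthonormal_split k r P1 P2 \<longleftrightarrow>
     P1 \<in> carrier_mat k r \<and> P2 \<in> carrier_mat k (k - r) \<and>
     transpose_mat P1 * P1 = 1\<^sub>m r \<and> transpose_mat P1 * P2 = 0\<^sub>m r (k - r) \<and>
     transpose_mat P2 * P1 = 0\<^sub>m (k - r) r \<and> transpose_mat P2 * P2 = 1\<^sub>m (k - r) \<and>
     P1 * transpose_mat P1 + P2 * transpose_mat P2 = 1\<^sub>m k"

lemma orthonormal_splitD:
  assumes "orthonormal_split k r P1 P2"
  shows "P1 \<in> carrier_mat k r" "P2 \<in> carrier_mat k (k - r)"
     "transpose_mat P1 * P1 = 1\<^sub>m r" "transpose_mat P1 * P2 = 0\<^sub>m r (k - r)"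
     "transpose_mat P2 * P1 = 0\<^sub>m (k - r) r" "transpose_mat P2 * P2 = 1\<^sub>m (k - r)"
     "P1 * transpose_mat P1 + P2 * transpose_mat P2 = 1\<^sub>m k"
  using assms by (auto simp: orthonormal_split_def)

lemma four_block_mat_inject:
  assumes "four_block_mat A B C D = four_block_mat A' B' C' D'"
    and "A \<in> carrier_mat r1 c1" "B \<in> carrier_mat r1 c2" "C \<in> carrier_mat r2 c1" "D \<in> carrier_mat r2 c2"
    and "A' \<in> carrier_mat r1 c1" "B' \<in> carrier_mat r1 c2" "C' \<in> carrier_mat r2 c1" "D' \<in> carrier_mat r2 c2"
  shows "A = A'" "B = B'" "C = C'" "D = D'"
proof -
  have e: "four_block_mat A B C D $$ (i,j) = four_block_mat A' B' C' D' $$ (i,j)" for i j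
    using assms(1) by simp
  show "A = A'"
  proof (rule eq_matI)
    fix i j assume "i < dim_row A'" "j < dim_col A'"
    then show "A $$ (i,j) = A' $$ (i,j)" using e[of i j] assms(2-9) by simp
  qed (use assms(2-9) in auto)
  show "B = B'"
  proof (rule eq_matI)
    fix i j assume "i < dim_row B'" "j < dim_col B'"
    then show "B $$ (i,j) = B' $$ (i,j)" using e[of i "c1 + j"] assms(2-9) by simp
  qed (use assms(2-9) in auto)
  show "C = C'"
  proof (rule eq_matI)
    fix i j assume "i < dim_row C'" "j < dim_col C'"
    then show "C $$ (i,j) = C' $$ (i,j)" using e[of "r1 + i" j] assms(2-9) by simp
  qed (use assms(2-9) in auto)
  show "D = D'"
  proof (rule eq_matI)
    fix i j assume "i < dim_row D'" "j < dim_col D'"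
    then show "D $$ (i,j) = D' $$ (i,j)" using e[of "r1 + i" "c1 + j"] assms(2-9) by simp
  qed (use assms(2-9) in auto)
qed

lemma orthonormal_split_append_cols:
  assumes P1: "P1 \<in> carrier_mat k r" and P2: "P2 \<in> carrier_mat k (k - r)"
    and o: "orthonormal_mat k (append_cols P1 P2)"
  shows "orthonormal_split k r P1 P2"
proof -
  note Q = orthonormal_matD[OF o]
  have ac: "append_cols P1 P2 = four_block_mat P1 P2 (0\<^sub>m 0 r) (0\<^sub>m 0 (k - r))"
    using P1 P2 by (simp add: append_cols_def)
  have "dim_col (append_cols P1 P2) = r + (k - r)" unfolding ac using P1 P2 by simp
  with Q(1) have rk: "r \<le> k" by auto
  have t: "transpose_mat (append_cols P1 P2)
      = four_block_mat (transpose_mat P1) (0\<^sub>m r 0) (transpose_mat P2) (0\<^sub>m (k - r) 0)"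
    unfolding ac by (subst transpose_four_block_mat[of _ k r _ "k - r" _ 0]) (use P1 P2 in auto)
  have "four_block_mat (transpose_mat P1 * P1) (transpose_mat P1 * P2) (transpose_mat P2 * P1) (transpose_mat P2 * P2)
      = four_block_mat (1\<^sub>m r) (0\<^sub>m r (k - r)) (0\<^sub>m (k - r) r) (1\<^sub>m (k - r))"
    using Q(2) rk unfolding t unfolding ac
    by (subst (asm) mult_four_block_mat[of _ r k _ 0 _ "k - r" _ _ r _ "k - r"]) (use P1 P2 in auto)
  note inj = four_block_mat_inject[OF this, of r r "k - r" "k - r"]
  have "four_block_mat (P1 * transpose_mat P1 + P2 * transpose_mat P2) (0\<^sub>m k 0) (0\<^sub>m 0 k) (0\<^sub>m 0 0) = 1\<^sub>m k"
    using Q(3) unfolding t unfolding ac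
    by (subst (asm) mult_four_block_mat[of _ k r _ "k - r" _ 0 _ _ k _ 0]) (use P1 P2 in auto)
  also have "\<dots> = four_block_mat (1\<^sub>m k) (0\<^sub>m k 0) (0\<^sub>m 0 k) (0\<^sub>m 0 0)"
    by (rule eq_matI) auto
  finally have s: "P1 * transpose_mat P1 + P2 * transpose_mat P2 = 1\<^sub>m k"
    by (rule four_block_mat_inject(1)[of _ _ _ _ _ _ _ _ k k 0 0]) (use P1 P2 in auto)
  show "orthonormal_split k r P1 P2"
    unfolding orthonormal_split_def using P1 P2 s inj by auto
qed

lemma full_svdD:
  assumes svd: "full_svd m n \<rho> L U1 U2 \<Sigma>1 V1 V2"
  shows "orthonormal_split m \<rho> U1 U2" "orthonormal_split n \<rho> V1 V2"
    "L = U1 * \<Sigma>1 * transpose_mat V1"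
proof -
  have c: "U1 \<in> carrier_mat m \<rho>" "U2 \<in> carrier_mat m (m - \<rho>)" "V1 \<in> carrier_mat n \<rho>"
    "V2 \<in> carrier_mat n (n - \<rho>)" "\<Sigma>1 \<in> carrier_mat \<rho> \<rho>"
    and o: "orthonormal_mat m (append_cols U1 U2)" "orthonormal_mat n (append_cols V1 V2)"
    and L: "L = append_cols U1 U2
         * four_block_mat \<Sigma>1 (0\<^sub>m \<rho> (n - \<rho>)) (0\<^sub>m (m - \<rho>) \<rho>) (0\<^sub>m (m - \<rho>) (n - \<rho>))
         * (transpose_mat V1 @\<^sub>r transpose_mat V2)"
    using svd by (auto simp: full_svd_def)
  show "orthonormal_split m \<rho> U1 U2"
    by (rule orthonormal_split_append_cols[OF c(1,2) o(1)])
  show "orthonormal_split n \<rho> V1 V2"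
    by (rule orthonormal_split_append_cols[OF c(3,4) o(2)])
  have "append_cols U1 U2
         * four_block_mat \<Sigma>1 (0\<^sub>m \<rho> (n - \<rho>)) (0\<^sub>m (m - \<rho>) \<rho>) (0\<^sub>m (m - \<rho>) (n - \<rho>))
      = four_block_mat (U1 * \<Sigma>1) (0\<^sub>m m (n - \<rho>)) (0\<^sub>m 0 \<rho>) (0\<^sub>m 0 (n - \<rho>))"
    unfolding append_cols_def
    by (subst mult_four_block_mat[of _ m \<rho> _ "m - \<rho>" _ 0 _ _ \<rho> _ "n - \<rho>"]) (use c in auto)
  then have "L = four_block_mat (U1 * \<Sigma>1) (0\<^sub>m m (n - \<rho>)) (0\<^sub>m 0 \<rho>) (0\<^sub>m 0 (n - \<rho>))
      * four_block_mat (transpose_mat V1) (0\<^sub>m \<rho> 0) (transpose_mat V2) (0\<^sub>m (n - \<rho>) 0)"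
    unfolding L append_rows_def using c by simp
  also have "\<dots> = four_block_mat (U1 * \<Sigma>1 * transpose_mat V1) (0\<^sub>m m 0) (0\<^sub>m 0 n) (0\<^sub>m 0 0)"
    by (subst mult_four_block_mat[of _ m \<rho> _ "n - \<rho>" _ 0 _ _ n _ 0]) (use c in auto)
  also have "\<dots> = U1 * \<Sigma>1 * transpose_mat V1"
    by (rule eq_matI) (use c in auto)
  finally show "L = U1 * \<Sigma>1 * transpose_mat V1" .
qed

text \<open>
  Pythagoras: the decomposition \<open>P1 P1\<^sup>T + P2 P2\<^sup>T = 1\<close> splits every vector orthogonally.
\<close>
lemma norm_orthonormal_split:
  assumes P: "orthonormal_split k r P1 P2" and x: "x \<in> carrier_vec k"
  shows "x \<bullet> x = (transpose_mat P1 *\<^sub>v x) \<bullet> (transpose_mat P1 *\<^sub>v x)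
    + (transpose_mat P2 *\<^sub>v x) \<bullet> (transpose_mat P2 *\<^sub>v x)"
proof -
  note p = orthonormal_splitD[OF P]
  have t: "transpose_mat P1 \<in> carrier_mat r k" "transpose_mat P2 \<in> carrier_mat (k - r) k"
    using p(1,2) by auto
  have sq: "P1 * transpose_mat P1 \<in> carrier_mat k k" "P2 * transpose_mat P2 \<in> carrier_mat k k"
    using p(1,2) by auto
  have "(transpose_mat P1 *\<^sub>v x) \<bullet> (transpose_mat P1 *\<^sub>v x) + (transpose_mat P2 *\<^sub>v x) \<bullet> (transpose_mat P2 *\<^sub>v x)
      = x \<bullet> (P1 * transpose_mat P1 *\<^sub>v x) + x \<bullet> (P2 * transpose_mat P2 *\<^sub>v x)"
    by (simp only: norm_mult_mat_vec[OF t(1) x] norm_mult_mat_vec[OF t(2) x] transpose_transpose)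
  also have "\<dots> = x \<bullet> (P1 * transpose_mat P1 *\<^sub>v x + P2 * transpose_mat P2 *\<^sub>v x)"
    by (rule scalar_prod_add_distrib[symmetric, of _ k])
       (use x mult_mat_vec_carrier[OF sq(1) x] mult_mat_vec_carrier[OF sq(2) x] in auto)
  also have "\<dots> = x \<bullet> x"
    unfolding add_mult_distrib_mat_vec[OF sq x, symmetric] p(7) using x by simp
  finally show ?thesis ..
qed

lemma fro_norm_split_rows:
  assumes P: "orthonormal_split k r P1 P2" and M: "M \<in> carrier_mat k n"
  shows "(fro_norm M)\<^sup>2 = (fro_norm (transpose_mat P1 * M))\<^sup>2 + (fro_norm (transpose_mat P2 * M))\<^sup>2"
proof -
  note p = orthonormal_splitD(1,2)[OF P]
  have c: "transpose_mat P1 * M \<in> carrier_mat r n" "transpose_mat P2 * M \<in> carrier_mat (k - r) n"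
    using p M by auto
  have col: "col (transpose_mat P1 * M) j = transpose_mat P1 *\<^sub>v col M j"
    "col (transpose_mat P2 * M) j = transpose_mat P2 *\<^sub>v col M j" if "j < n" for j
    using that p M by (auto intro!: eq_vecI)
  have "(fro_norm M)\<^sup>2 = (\<Sum>j<n. col M j \<bullet> col M j)"
    unfolding fro_norm_sq[OF M] trace_inner_eq_sum_cols[OF M M] ..
  also have "\<dots> = (\<Sum>j<n. col (transpose_mat P1 * M) j \<bullet> col (transpose_mat P1 * M) j
      + col (transpose_mat P2 * M) j \<bullet> col (transpose_mat P2 * M) j)"
  proof (rule sum.cong)
    fix j assume "j \<in> {..<n}"
    then have j: "j < n" by simp
    show "col M j \<bullet> col M j = col (transpose_mat P1 * M) j \<bullet> col (transpose_mat P1 * M) j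
      + col (transpose_mat P2 * M) j \<bullet> col (transpose_mat P2 * M) j"
      unfolding col[OF j] by (rule norm_orthonormal_split[OF P]) (use M j in simp)
  qed simp
  also have "\<dots> = (fro_norm (transpose_mat P1 * M))\<^sup>2 + (fro_norm (transpose_mat P2 * M))\<^sup>2"
    unfolding sum.distrib fro_norm_sq[OF c(1)] fro_norm_sq[OF c(2)]
      trace_inner_eq_sum_cols[OF c(1,1)] trace_inner_eq_sum_cols[OF c(2,2)] ..
  finally show ?thesis .
qed

lemma fro_norm_split_cols:
  assumes P: "orthonormal_split k r P1 P2" and M: "M \<in> carrier_mat n k"
  shows "(fro_norm M)\<^sup>2 = (fro_norm (M * P1))\<^sup>2 + (fro_norm (M * P2))\<^sup>2"
proof -
  note p = orthonormal_splitD(1,2)[OF P]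
  have "transpose_mat P1 * transpose_mat M = transpose_mat (M * P1)"
    "transpose_mat P2 * transpose_mat M = transpose_mat (M * P2)"
    using p M by (simp_all add: transpose_mult_dim)
  then show ?thesis
    using fro_norm_split_rows[OF P, of "transpose_mat M" n] M by (simp add: fro_norm_transpose)
qed

lemma fro_norm_split_blocks:
  assumes U: "orthonormal_split m r U1 U2" and V: "orthonormal_split n r' V1 V2"
    and M: "M \<in> carrier_mat m n"
  shows "(fro_norm M)\<^sup>2 =
      (fro_norm (transpose_mat U1 * M * V1))\<^sup>2 + (fro_norm (transpose_mat U1 * M * V2))\<^sup>2
    + (fro_norm (transpose_mat U2 * M * V1))\<^sup>2 + (fro_norm (transpose_mat U2 * M * V2))\<^sup>2"
proof -
  note u = orthonormal_splitD(1,2)[OF U]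
  have c: "transpose_mat U1 * M \<in> carrier_mat r n" "transpose_mat U2 * M \<in> carrier_mat (m - r) n"
    using u M by auto
  show ?thesis
    using fro_norm_split_rows[OF U M] fro_norm_split_cols[OF V c(1)] fro_norm_split_cols[OF V c(2)]
    by simp
qed

lemma trace_inner_outer:
  assumes G: "G \<in> carrier_mat m n" and x: "x \<in> carrier_vec m" and y: "y \<in> carrier_vec n"
  shows "trace_inner G (mat m n (\<lambda>(i,j). x $ i * y $ j)) = x \<bullet> (G *\<^sub>v y)"
proof -
  have "trace_inner G (mat m n (\<lambda>(i,j). x $ i * y $ j)) = (\<Sum>i<m. \<Sum>j<n. G $$ (i,j) * (x $ i * y $ j))"
    using G by (simp add: trace_inner_eq_sum[of _ m n])
  also have "\<dots> = (\<Sum>i<m. x $ i * (\<Sum>j<n. G $$ (i,j) * y $ j))"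
    by (simp add: sum_distrib_left mult_ac)
  also have "\<dots> = x \<bullet> (G *\<^sub>v y)"
    using G x y by (simp add: scalar_prod_def atLeast0LessThan)
  finally show ?thesis .
qed

lemma le_if_le_sqrt_mult_sqrt:
  fixes a b :: real
  assumes "0 \<le> a" "0 \<le> b" "a \<le> sqrt a * sqrt b"
  shows "a \<le> b"
proof (cases "a = 0")
  case False
  with assms have "sqrt a * sqrt a \<le> sqrt a * sqrt b" "0 < sqrt a" by simp_all
  then have "sqrt a \<le> sqrt b" by (simp only: mult_le_cancel_left_pos)
  then show ?thesis by simp
qed (use assms in simp)

section \<open>Contractions\<close>

text \<open>
  Testing with the rank-one matrix \<open>Z = (G y) y\<^sup>T\<close> gives \<open>\<parallel>G y\<parallel>\<^sup>2\<close> on the left. On the right,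
  duality bounds its nuclear norm by \<open>\<parallel>G y\<parallel> \<parallel>y\<parallel>\<close> without any computation of eigenvalues.
\<close>
lemma contraction_if_trace_inner_le:
  assumes G: "G \<in> carrier_mat m n"
    and le: "\<And>Z. Z \<in> carrier_mat m n \<Longrightarrow> trace_inner G Z \<le> nuclear_norm Z"
  shows "contraction n G"
  unfolding contraction_def
proof
  fix y :: "real vec" assume y: "y \<in> carrier_vec n"
  let ?x = "G *\<^sub>v y"
  have x: "?x \<in> carrier_vec m" using G y by simp
  let ?Z = "mat m n (\<lambda>(i,j). ?x $ i * y $ j)"
  have Z: "?Z \<in> carrier_mat m n" by simp
  obtain H where H: "H \<in> carrier_mat m n" "contraction n H" and eq: "trace_inner H ?Z = nuclear_norm ?Z"
    by (rule nuclear_norm_attained[OF Z])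
  have nn: "?x \<bullet> ?x \<ge> 0" "y \<bullet> y \<ge> 0" by (rule scalar_prod_self_nonneg)+
  have "?x \<bullet> ?x = trace_inner G ?Z" by (rule trace_inner_outer[OF G x y, symmetric])
  also have "\<dots> \<le> trace_inner H ?Z" unfolding eq by (rule le[OF Z])
  also have "\<dots> = ?x \<bullet> (H *\<^sub>v y)" by (rule trace_inner_outer[OF H(1) x y])
  also have "\<dots> \<le> sqrt (?x \<bullet> ?x) * sqrt ((H *\<^sub>v y) \<bullet> (H *\<^sub>v y))"
    by (rule Cauchy_Schwarz_vec[OF x]) (use H y in simp)
  also have "\<dots> \<le> sqrt (?x \<bullet> ?x) * sqrt (y \<bullet> y)"
    using H(2) y nn by (intro mult_left_mono) (auto simp: contraction_def)
  finally show "?x \<bullet> ?x \<le> y \<bullet> y" by (rule le_if_le_sqrt_mult_sqrt[OF nn])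
qed

lemma contraction_transpose:
  assumes G: "G \<in> carrier_mat m n" and c: "contraction n G"
  shows "contraction m (transpose_mat G)"
  unfolding contraction_def
proof
  fix x :: "real vec" assume x: "x \<in> carrier_vec m"
  let ?y = "transpose_mat G *\<^sub>v x"
  have y: "?y \<in> carrier_vec n" using G x by simp
  have nn: "x \<bullet> x \<ge> 0" "?y \<bullet> ?y \<ge> 0" by (rule scalar_prod_self_nonneg)+
  have "?y \<bullet> ?y = x \<bullet> (G *\<^sub>v ?y)" by (rule transpose_vec_mult_scalar[OF G y x])
  also have "\<dots> \<le> sqrt (x \<bullet> x) * sqrt ((G *\<^sub>v ?y) \<bullet> (G *\<^sub>v ?y))"
    by (rule Cauchy_Schwarz_vec[OF x]) (use G y in simp)
  also have "\<dots> \<le> sqrt (x \<bullet> x) * sqrt (?y \<bullet> ?y)"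
    using c y nn by (intro mult_left_mono) (auto simp: contraction_def)
  finally have "?y \<bullet> ?y \<le> sqrt (?y \<bullet> ?y) * sqrt (x \<bullet> x)" by (simp add: mult.commute)
  then show "?y \<bullet> ?y \<le> x \<bullet> x" by (rule le_if_le_sqrt_mult_sqrt[OF nn(2,1)])
qed

lemma orthonormal_cols:
  assumes P: "P \<in> carrier_mat k r" "transpose_mat P * P = 1\<^sub>m r" and i: "i < r"
  shows "col P i \<in> carrier_vec k" "col P i \<bullet> col P i = 1"
proof -
  show "col P i \<in> carrier_vec k" using P(1) i by simp
  have "(transpose_mat P * P) $$ (i,i) = 1" unfolding P(2) using i by simp
  then show "col P i \<bullet> col P i = 1" using P(1) i by simp
qed

lemma index_compression:
  assumes "U \<in> carrier_mat m r" "V \<in> carrier_mat n r" "G \<in> carrier_mat m n" "i < r"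
  shows "(transpose_mat U * G * V) $$ (i,i) = col U i \<bullet> (G *\<^sub>v col V i)"
proof -
  have "transpose_mat U * G * V = transpose_mat U * (G * V)"
    using assms by (simp add: mult_mat_assoc)
  moreover have "col (G * V) i = G *\<^sub>v col V i" using assms by (auto intro!: eq_vecI)
  ultimately show ?thesis using assms by (simp del: col_mult)
qed

lemma contraction_compression_le_1:
  assumes G: "G \<in> carrier_mat m n" "contraction n G"
    and U: "U \<in> carrier_mat m r" "transpose_mat U * U = 1\<^sub>m r"
    and V: "V \<in> carrier_mat n r" "transpose_mat V * V = 1\<^sub>m r" and i: "i < r"
  shows "(transpose_mat U * G * V) $$ (i,i) \<le> 1"
proof -
  note u = orthonormal_cols[OF U i] and v = orthonormal_cols[OF V i]
  let ?g = "G *\<^sub>v col V i"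
  have "?g \<bullet> ?g \<le> 1"
    using G(2) v unfolding contraction_def by metis
  then have g: "sqrt (?g \<bullet> ?g) \<le> 1" by simp
  have "col U i \<bullet> ?g \<le> sqrt (col U i \<bullet> col U i) * sqrt (?g \<bullet> ?g)"
    by (rule Cauchy_Schwarz_vec[OF u(1)]) (use G(1) v(1) in simp)
  also have "\<dots> = sqrt (?g \<bullet> ?g)" unfolding u(2) by simp
  finally show ?thesis
    unfolding index_compression[OF U(1) V(1) G(1) i] using g by linarith
qed

text \<open>
  The equality case of Cauchy-Schwarz: \<open>u \<bullet> G v = 1\<close> with \<open>u\<close> of length 1 and \<open>G v\<close> of length at
  most 1 forces \<open>G v = u\<close>.
\<close>
lemma contraction_aligned:
  assumes G: "G \<in> carrier_mat m n" "contraction n G"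
    and U: "U \<in> carrier_mat m r" "transpose_mat U * U = 1\<^sub>m r"
    and V: "V \<in> carrier_mat n r" "transpose_mat V * V = 1\<^sub>m r"
    and one: "\<And>i. i < r \<Longrightarrow> (transpose_mat U * G * V) $$ (i,i) = 1"
  shows "G * V = U"
proof (rule mat_col_eqI)
  fix i assume "i < dim_col U"
  then have i: "i < r" using U(1) by simp
  note u = orthonormal_cols[OF U i] and v = orthonormal_cols[OF V i]
  let ?g = "G *\<^sub>v col V i"
  have g: "?g \<in> carrier_vec m" using G(1) v(1) by simp
  have gg: "?g \<bullet> ?g \<le> 1" using G(2) v unfolding contraction_def by metis
  have ug: "col U i \<bullet> ?g = 1" using one[OF i] index_compression[OF U(1) V(1) G(1) i] by simp
  have "(?g - col U i) \<bullet> (?g - col U i) = ?g \<bullet> ?g - 2 * (col U i \<bullet> ?g) + col U i \<bullet> col U i"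
    using g u(1) comm_scalar_prod[OF g u(1)]
    by (simp add: minus_scalar_prod_distrib[of _ m] scalar_prod_minus_distrib[of _ m])
  also have "\<dots> \<le> 0" using gg ug u(2) by simp
  finally have "(?g - col U i) \<bullet> (?g - col U i) = 0"
    using scalar_prod_self_nonneg[of "?g - col U i"] by simp
  then have z: "?g - col U i = 0\<^sub>v m"
    by (rule scalar_prod_self_eq_0[rotated]) (use g u(1) in simp)
  have "?g = col U i"
  proof (rule eq_vecI)
    fix j assume "j < dim_vec (col U i)"
    then show "?g $ j = col U i $ j" using arg_cong[OF z, of "\<lambda>w. w $ j"] u(1) U(1) by simp
  qed (use G(1) U(1) in simp)
  moreover have "col (G * V) i = ?g" using G(1) V(1) i by (auto intro!: eq_vecI)
  ultimately show "col (G * V) i = col U i" by simp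
qed (use G U V in auto)

lemma contraction_uminus:
  assumes "W \<in> carrier_mat p q" 
  shows "contraction q (- W) \<longleftrightarrow> contraction q W"
proof -
  have "(- W *\<^sub>v y) \<bullet> (- W *\<^sub>v y) = (W *\<^sub>v y) \<bullet> (W *\<^sub>v y)" if "y \<in> carrier_vec q" for y
    using assms that by simp
  then show ?thesis by (simp add: contraction_def)
qed

section \<open>The subdifferential of the nuclear norm\<close>

locale svd_split =
  fixes m n \<rho> :: nat and U1 U2 V1 V2 \<Sigma>1 :: "real mat"
  assumes U: "orthonormal_split m \<rho> U1 U2" and V: "orthonormal_split n \<rho> V1 V2"
    and \<Sigma>: "\<Sigma>1 \<in> carrier_mat \<rho> \<rho>" "diagonal_mat \<Sigma>1" "\<And>i. i < \<rho> \<Longrightarrow> \<Sigma>1 $$ (i,i) > 0"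
begin

abbreviation "L \<equiv> U1 * \<Sigma>1 * transpose_mat V1"

lemmas u = orthonormal_splitD[OF U] and v = orthonormal_splitD[OF V]

lemma L_carrier: "L \<in> carrier_mat m n"
  using u(1) v(1) \<Sigma>(1) by auto

lemma trace_inner_L:
  assumes G: "G \<in> carrier_mat m n"
  shows "trace_inner G L = (\<Sum>i<\<rho>. (transpose_mat U1 * G * V1) $$ (i,i) * \<Sigma>1 $$ (i,i))"
proof -
  let ?K = "transpose_mat U1 * G * V1"
  have K: "?K \<in> carrier_mat \<rho> \<rho>" using u(1) v(1) G by auto
  have "trace_inner G L = mat_trace ((transpose_mat G * U1 * \<Sigma>1) * transpose_mat V1)"
    using u(1) v(1) \<Sigma>(1) G by (simp add: trace_inner_def mult_mat_assoc)
  also have "\<dots> = mat_trace (transpose_mat V1 * (transpose_mat G * U1 * \<Sigma>1))"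
    by (rule mat_trace_comm[of _ n \<rho>]) (use u(1) v(1) \<Sigma>(1) G in auto)
  also have "\<dots> = trace_inner ?K \<Sigma>1"
    using u(1) v(1) \<Sigma>(1) G by (simp add: trace_inner_def transpose_mult_dim mult_mat_assoc)
  also have "\<dots> = (\<Sum>i<\<rho>. \<Sum>j<\<rho>. if j = i then ?K $$ (i,i) * \<Sigma>1 $$ (i,i) else 0)"
    unfolding trace_inner_eq_sum[OF K \<Sigma>(1)]
    using \<Sigma>(1,2) by (intro sum.cong) (auto simp: diagonal_mat_def)
  finally show ?thesis by simp
qed

lemma contraction_of_blocks:
  assumes X: "X \<in> carrier_mat m n"
    and b: "transpose_mat U1 * X * V1 = 1\<^sub>m \<rho>" "transpose_mat U1 * X * V2 = 0\<^sub>m \<rho> (n - \<rho>)"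
      "transpose_mat U2 * X * V1 = 0\<^sub>m (m - \<rho>) \<rho>" and c: "contraction (n - \<rho>) (transpose_mat U2 * X * V2)"
  shows "contraction n X"
  unfolding contraction_def
proof
  fix y :: "real vec" assume y: "y \<in> carrier_vec n"
  define y1 where "y1 = transpose_mat V1 *\<^sub>v y"
  define y2 where "y2 = transpose_mat V2 *\<^sub>v y"
  have y12: "y1 \<in> carrier_vec \<rho>" "y2 \<in> carrier_vec (n - \<rho>)" using v(1,2) y by (auto simp: y1_def y2_def)
  have "y = (V1 * transpose_mat V1 + V2 * transpose_mat V2) *\<^sub>v y" unfolding v(7) using y by simp
  also have "\<dots> = V1 *\<^sub>v y1 + V2 *\<^sub>v y2"
    using v(1,2) y by (subst add_mult_distrib_mat_vec[of _ n n]) (auto simp: y1_def y2_def mult_mat_vec_assoc)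
  finally have ysum: "y = V1 *\<^sub>v y1 + V2 *\<^sub>v y2" .
  have blk: "transpose_mat P *\<^sub>v (X *\<^sub>v y) = (transpose_mat P * X * V1) *\<^sub>v y1 + (transpose_mat P * X * V2) *\<^sub>v y2"
    if P: "P \<in> carrier_mat m r" for P r
  proof -
    have PX: "transpose_mat P * X \<in> carrier_mat r n" using P X by auto
    have "transpose_mat P *\<^sub>v (X *\<^sub>v y) = (transpose_mat P * X) *\<^sub>v y"
      using P X y by (simp add: mult_mat_vec_assoc)
    also have "\<dots> = (transpose_mat P * X) *\<^sub>v (V1 *\<^sub>v y1) + (transpose_mat P * X) *\<^sub>v (V2 *\<^sub>v y2)"
      by (subst (1) ysum, rule mult_add_distrib_mat_vec[OF PX]) (use v(1,2) y12 in auto)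
    finally show ?thesis
      using assoc_mult_mat_vec[OF PX v(1) y12(1)] assoc_mult_mat_vec[OF PX v(2) y12(2)] by simp
  qed
  have 1: "transpose_mat U1 *\<^sub>v (X *\<^sub>v y) = y1"
    unfolding blk[OF u(1)] b using y12 by (auto intro!: eq_vecI)
  have W: "transpose_mat U2 * X * V2 \<in> carrier_mat (m - \<rho>) (n - \<rho>)" using u(2) v(2) X by auto
  have 2: "transpose_mat U2 *\<^sub>v (X *\<^sub>v y) = (transpose_mat U2 * X * V2) *\<^sub>v y2"
    unfolding blk[OF u(2)] b using y12 W by (auto intro!: eq_vecI)
  have "(X *\<^sub>v y) \<bullet> (X *\<^sub>v y) = y1 \<bullet> y1
      + ((transpose_mat U2 * X * V2) *\<^sub>v y2) \<bullet> ((transpose_mat U2 * X * V2) *\<^sub>v y2)"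
    unfolding 1[symmetric] 2[symmetric] by (rule norm_orthonormal_split[OF U]) (use X y in simp)
  also have "\<dots> \<le> y1 \<bullet> y1 + y2 \<bullet> y2"
    using c y12(2) unfolding contraction_def by (intro add_left_mono) blast
  also have "\<dots> = y \<bullet> y"
    unfolding y1_def y2_def by (rule norm_orthonormal_split[OF V y, symmetric])
  finally show "(X *\<^sub>v y) \<bullet> (X *\<^sub>v y) \<le> y \<bullet> y" .
qed

lemma blocks_of_combination:
  assumes W: "W \<in> carrier_mat (m - \<rho>) (n - \<rho>)"
  defines "X \<equiv> U1 * transpose_mat V1 + U2 * W * transpose_mat V2"
  shows "X \<in> carrier_mat m n"
    "transpose_mat U1 * X * V1 = 1\<^sub>m \<rho>" "transpose_mat U1 * X * V2 = 0\<^sub>m \<rho> (n - \<rho>)"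
    "transpose_mat U2 * X * V1 = 0\<^sub>m (m - \<rho>) \<rho>" "transpose_mat U2 * X * V2 = W"
proof -
  show "X \<in> carrier_mat m n" using u(1,2) v(1,2) W by (auto simp: X_def)
  have blk: "transpose_mat P * X * R = (transpose_mat P * U1) * (transpose_mat V1 * R)
      + (transpose_mat P * U2) * W * (transpose_mat V2 * R)"
    if P: "P \<in> carrier_mat m r" and R: "R \<in> carrier_mat n r'" for P R r r'
  proof -
    have "transpose_mat P * X = transpose_mat P * (U1 * transpose_mat V1) + transpose_mat P * (U2 * W * transpose_mat V2)"
      unfolding X_def by (rule mult_add_distrib_mat[of _ r m _ n]) (use P u(1,2) v(1,2) W in auto)
    then have "transpose_mat P * X * R = transpose_mat P * (U1 * transpose_mat V1) * R
        + transpose_mat P * (U2 * W * transpose_mat V2) * R"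
      by (simp only:) (rule add_mult_distrib_mat[of _ r n _ _ r'], use P R u(1,2) v(1,2) W in auto)
    then show ?thesis using P R u(1,2) v(1,2) W by (simp add: mult_mat_assoc)
  qed
  show "transpose_mat U1 * X * V1 = 1\<^sub>m \<rho>"
    unfolding blk[OF u(1) v(1)] u v using W by simp
  show "transpose_mat U1 * X * V2 = 0\<^sub>m \<rho> (n - \<rho>)"
    unfolding blk[OF u(1) v(2)] u v using W by simp
  show "transpose_mat U2 * X * V1 = 0\<^sub>m (m - \<rho>) \<rho>"
    unfolding blk[OF u(2) v(1)] u v using W by simp
  show "transpose_mat U2 * X * V2 = W"
    unfolding blk[OF u(2) v(2)] u v using W by simp
qed

text \<open>
  Both inequalities come from duality: a contraction \<open>G\<close> has \<open>u\<^sub>i \<bullet> G v\<^sub>i \<le> 1\<close>, and the contraction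
  \<open>U1 V1\<^sup>T\<close>, written as the combination with the zero block, reaches the value 1 for every \<open>i\<close>.
\<close>
lemma nuclear_norm_L: "nuclear_norm L = (\<Sum>i<\<rho>. \<Sigma>1 $$ (i,i))"
proof (rule antisym)
  obtain G where G: "G \<in> carrier_mat m n" "contraction n G" and eq: "trace_inner G L = nuclear_norm L"
    by (rule nuclear_norm_attained[OF L_carrier])
  show "nuclear_norm L \<le> (\<Sum>i<\<rho>. \<Sigma>1 $$ (i,i))"
    unfolding eq[symmetric] trace_inner_L[OF G(1)]
  proof (rule sum_mono)
    fix i assume "i \<in> {..<\<rho>}"
    then have i: "i < \<rho>" by simp
    from mult_right_mono[OF contraction_compression_le_1[OF G u(1,3) v(1,3) i], of "\<Sigma>1 $$ (i,i)"] \<Sigma>(3)[OF i]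
    show "(transpose_mat U1 * G * V1) $$ (i,i) * \<Sigma>1 $$ (i,i) \<le> \<Sigma>1 $$ (i,i)" by simp
  qed
next
  let ?X = "U1 * transpose_mat V1 + U2 * 0\<^sub>m (m - \<rho>) (n - \<rho>) * transpose_mat V2"
  note X = blocks_of_combination[OF zero_carrier_mat]
  have "contraction (n - \<rho>) (0\<^sub>m (m - \<rho>) (n - \<rho>))"
  proof -
    have "0\<^sub>m (m - \<rho>) (n - \<rho>) *\<^sub>v x = 0\<^sub>v (m - \<rho>)" if "x \<in> carrier_vec (n - \<rho>)" for x :: "real vec"
      using that by (intro eq_vecI) auto
    then show ?thesis using scalar_prod_self_nonneg by (simp add: contraction_def)
  qed
  then have "contraction n ?X" using X by (intro contraction_of_blocks) simp_all
  then have "trace_inner ?X L \<le> nuclear_norm L"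
    by (rule trace_inner_le_nuclear_norm[OF X(1) L_carrier])
  then show "(\<Sum>i<\<rho>. \<Sigma>1 $$ (i,i)) \<le> nuclear_norm L"
    unfolding trace_inner_L[OF X(1)] X(2) by simp
qed

text \<open>
  The known description \<open>X = U1 V1\<^sup>T + U2 W V2\<^sup>T\<close> with \<open>W\<close> a contraction, in terms of the blocks
  of \<open>X\<close>. By homogeneity, a subgradient satisfies \<open>\<langle>X, L\<rangle> = \<parallel>L\<parallel>\<^sub>*\<close> and is dual feasible, that
  is, a contraction. Equality in \<open>\<Sum>\<^sub>i \<sigma>\<^sub>i (u\<^sub>i \<bullet> X v\<^sub>i) \<le> \<Sum>\<^sub>i \<sigma>\<^sub>i\<close> with all \<open>\<sigma>\<^sub>i\<close> positive forces
  \<open>u\<^sub>i \<bullet> X v\<^sub>i = 1\<close>, hence \<open>X V1 = U1\<close> and, for the transpose, \<open>X\<^sup>T U1 = V1\<close>. This fixes three of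
  the blocks.
\<close>
lemma subdifferential_nuclear_norm_iff:
  "X \<in> subdifferential m n nuclear_norm L \<longleftrightarrow>
     X \<in> carrier_mat m n \<and> transpose_mat U1 * X * V1 = 1\<^sub>m \<rho> \<and>
     transpose_mat U1 * X * V2 = 0\<^sub>m \<rho> (n - \<rho>) \<and> transpose_mat U2 * X * V1 = 0\<^sub>m (m - \<rho>) \<rho> \<and>
     contraction (n - \<rho>) (transpose_mat U2 * X * V2)" (is "?l \<longleftrightarrow> ?r")
proof
  assume ?r
  then have X: "X \<in> carrier_mat m n" and X1: "transpose_mat U1 * X * V1 = 1\<^sub>m \<rho>" and c: "contraction n X"
    by (auto intro: contraction_of_blocks)
  have XL: "trace_inner X L = nuclear_norm L"
    unfolding trace_inner_L[OF X] X1 nuclear_norm_L by simp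
  show ?l
    unfolding subdifferential_def
  proof (intro CollectI conjI ballI X)
    fix Z :: "real mat" assume Z: "Z \<in> carrier_mat m n"
    show "nuclear_norm Z \<ge> nuclear_norm L + trace_inner X (Z - L)"
      using trace_inner_le_nuclear_norm[OF X Z c] XL trace_inner_diff_right[OF X Z L_carrier] by simp
  qed
next
  assume ?l
  note X = subdifferentialD[OF this]
  have ineq: "nuclear_norm L + (trace_inner X Z - trace_inner X L) \<le> nuclear_norm Z"
    if Z: "Z \<in> carrier_mat m n" for Z
    using X(2)[OF Z] trace_inner_diff_right[OF X(1) Z L_carrier] by simp
  have "trace_inner X L = nuclear_norm L"
  proof (rule antisym)
    have "nuclear_norm (2 \<cdot>\<^sub>m L + 0 \<cdot>\<^sub>m L) \<le> 2 * nuclear_norm L + 0 * nuclear_norm L"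
      by (rule nuclear_norm_combination_le[OF L_carrier L_carrier]) auto
    moreover have "2 \<cdot>\<^sub>m L + 0 \<cdot>\<^sub>m L = 2 \<cdot>\<^sub>m L" using L_carrier by (intro eq_matI) auto
    ultimately show "trace_inner X L \<le> nuclear_norm L"
      using ineq[of "2 \<cdot>\<^sub>m L"] L_carrier trace_inner_smult_right[OF X(1) L_carrier, of 2] by simp
    have "trace_inner X (0\<^sub>m m n) = 0" using X(1) by (simp add: trace_inner_eq_sum[of _ m n])
    then show "nuclear_norm L \<le> trace_inner X L"
      using ineq[of "0\<^sub>m m n"] nuclear_norm_zero by simp
  qed
  then have XL: "trace_inner X L = nuclear_norm L" .
  have c: "contraction n X"
    by (rule contraction_if_trace_inner_le[OF X(1)]) (use ineq XL in force)
  note ct = contraction_transpose[OF X(1) c]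
  let ?K = "transpose_mat U1 * X * V1"
  have K1: "?K $$ (i,i) = 1" if i: "i < \<rho>" for i
  proof -
    have K: "?K $$ (j,j) \<le> 1" if "j < \<rho>" for j
      by (rule contraction_compression_le_1[OF X(1) c u(1,3) v(1,3) that])
    have "(\<Sum>j<\<rho>. (1 - ?K $$ (j,j)) * \<Sigma>1 $$ (j,j)) = 0"
      using XL unfolding trace_inner_L[OF X(1)] nuclear_norm_L by (simp add: algebra_simps sum_subtractf)
    moreover have "(1 - ?K $$ (j,j)) * \<Sigma>1 $$ (j,j) \<ge> 0" if "j < \<rho>" for j
      using K[OF that] \<Sigma>(3)[OF that] by simp
    ultimately have "(1 - ?K $$ (i,i)) * \<Sigma>1 $$ (i,i) = 0"
      using i by (subst (asm) sum_nonneg_eq_0_iff) auto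
    with \<Sigma>(3)[OF i] show ?thesis by simp
  qed
  have XV: "X * V1 = U1"
    by (rule contraction_aligned[OF X(1) c u(1,3) v(1,3) K1])
  have Xt: "transpose_mat X \<in> carrier_mat n m" using X(1) by simp
  have XU: "transpose_mat X * U1 = V1"
  proof (rule contraction_aligned[OF Xt ct v(1,3) u(1,3)])
    fix i assume i: "i < \<rho>"
    have "transpose_mat V1 * transpose_mat X * U1 = transpose_mat ?K"
      using u(1) v(1) X(1) by (simp add: transpose_mult_dim mult_mat_assoc)
    then show "(transpose_mat V1 * transpose_mat X * U1) $$ (i,i) = 1"
      using K1[OF i] i u(1) v(1) X(1) by simp
  qed
  have UX: "transpose_mat U1 * X = transpose_mat V1"
    using arg_cong[OF XU, of transpose_mat] u(1) X(1) by (simp add: transpose_mult_dim)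
  have b1: "transpose_mat U1 * X * V1 = 1\<^sub>m \<rho>" unfolding UX by (rule v(3))
  have b2: "transpose_mat U1 * X * V2 = 0\<^sub>m \<rho> (n - \<rho>)" unfolding UX by (rule v(4))
  have "transpose_mat U2 * X * V1 = transpose_mat U2 * (X * V1)"
    using u(2) v(1) X(1) by (simp add: mult_mat_assoc)
  then have b3: "transpose_mat U2 * X * V1 = 0\<^sub>m (m - \<rho>) \<rho>" unfolding XV u(5) .
  have b4: "contraction (n - \<rho>) (transpose_mat U2 * X * V2)"
    unfolding contraction_def
  proof
    fix y :: "real vec" assume y: "y \<in> carrier_vec (n - \<rho>)"
    have Vy: "V2 *\<^sub>v y \<in> carrier_vec n" using v(2) y by simp
    let ?z = "X *\<^sub>v (V2 *\<^sub>v y)"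
    have eq: "(transpose_mat U2 * X * V2) *\<^sub>v y = transpose_mat U2 *\<^sub>v ?z"
      using u(2) v(2) X(1) y by (simp add: mult_mat_vec_assoc)
    have "(transpose_mat U2 *\<^sub>v ?z) \<bullet> (transpose_mat U2 *\<^sub>v ?z) \<le> ?z \<bullet> ?z"
      using norm_orthonormal_split[OF U, of ?z] X(1) Vy scalar_prod_self_nonneg[of "transpose_mat U1 *\<^sub>v ?z"]
      by simp
    also have "\<dots> \<le> (V2 *\<^sub>v y) \<bullet> (V2 *\<^sub>v y)" using c Vy by (simp add: contraction_def)
    also have "\<dots> = y \<bullet> y" unfolding norm_mult_mat_vec[OF v(2) y] v(6) using y by simp
    finally show "((transpose_mat U2 * X * V2) *\<^sub>v y) \<bullet> ((transpose_mat U2 * X * V2) *\<^sub>v y) \<le> y \<bullet> y"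
      unfolding eq .
  qed
  from X(1) b1 b2 b3 b4 show ?r by blast
qed

text \<open>
  Only the last term depends on the subgradient. Its free block enters with a double negation so
  that the term is a distance to \<open>U2\<^sup>T D V2\<close>.
\<close>
lemma fro_norm_sq_subgradient_add:
  assumes X: "X \<in> subdifferential m n nuclear_norm L" and D: "D \<in> carrier_mat m n"
  shows "(fro_norm (X + D))\<^sup>2 =
      (fro_norm (1\<^sub>m \<rho> + transpose_mat U1 * D * V1))\<^sup>2 + (fro_norm (transpose_mat U1 * D * V2))\<^sup>2
    + (fro_norm (transpose_mat U2 * D * V1))\<^sup>2
    + (fro_norm (transpose_mat U2 * D * V2 - - (transpose_mat U2 * X * V2)))\<^sup>2"
proof -
  from X have X: "X \<in> carrier_mat m n" and b: "transpose_mat U1 * X * V1 = 1\<^sub>m \<rho>"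
      "transpose_mat U1 * X * V2 = 0\<^sub>m \<rho> (n - \<rho>)" "transpose_mat U2 * X * V1 = 0\<^sub>m (m - \<rho>) \<rho>"
    unfolding subdifferential_nuclear_norm_iff by auto
  have blk: "transpose_mat P * (X + D) * R = transpose_mat P * X * R + transpose_mat P * D * R"
    if P: "P \<in> carrier_mat m r" and R: "R \<in> carrier_mat n r'" for P R r r'
  proof -
    have "transpose_mat P * (X + D) = transpose_mat P * X + transpose_mat P * D"
      by (rule mult_add_distrib_mat[of _ r m _ n]) (use P X D in auto)
    then show ?thesis
      by (simp only:) (rule add_mult_distrib_mat[of _ r n _ _ r'], use P R X D in auto)
  qed
  have c: "transpose_mat U1 * D * V2 \<in> carrier_mat \<rho> (n - \<rho>)" "transpose_mat U2 * D * V1 \<in> carrier_mat (m - \<rho>) \<rho>"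
    "transpose_mat U2 * D * V2 \<in> carrier_mat (m - \<rho>) (n - \<rho>)" "transpose_mat U2 * X * V2 \<in> carrier_mat (m - \<rho>) (n - \<rho>)"
    using u(1,2) v(1,2) D X by auto
  have "transpose_mat U2 * X * V2 + transpose_mat U2 * D * V2
      = transpose_mat U2 * D * V2 - - (transpose_mat U2 * X * V2)"
    using c(3,4) by (intro eq_matI) auto
  then show ?thesis
    unfolding fro_norm_split_blocks[OF U V add_carrier_mat[OF D]]
      blk[OF u(1) v(1)] blk[OF u(1) v(2)] blk[OF u(2) v(1)] blk[OF u(2) v(2)] b
    using c(1,2) by simp
qed

end

section \<open>Least-norm subgradients and the optimality gap\<close>

theorem mainTheorem2:
  fixes m n \<rho> :: nat
    and \<phi> F :: "real mat \<Rightarrow> real"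
    and L U1 U2 \<Sigma>1 V1 V2 D :: "real mat"
  assumes convex: "mat_convex_fun m n \<phi>"
    and F: "F = (\<lambda>X. nuclear_norm X + \<phi> X)"
    and L: "L \<in> carrier_mat m n"
    and rank: "vec_space.rank m L = \<rho>"
    and svd: "full_svd m n \<rho> L U1 U2 \<Sigma>1 V1 V2"
    and D: "D \<in> subdifferential m n \<phi> L"
  shows
    "subdifferential m n nuclear_norm L + subdifferential m n \<phi> L = subdifferential m n F L
     \<and>
     (\<exists>E \<in> subdifferential m n nuclear_norm L + subdifferential m n \<phi> L. \<exists>w.
        is_min_value (\<lambda>X. (fro_norm (X + D))\<^sup>2) (subdifferential m n nuclear_norm L)
          ((fro_norm E)\<^sup>2)
        \<and> is_min_value (\<lambda>W. (fro_norm (transpose_mat U2 * D * V2 - W))\<^sup>2)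
            {W \<in> carrier_mat (m - \<rho>) (n - \<rho>). spectral_norm W \<le> 1} w
        \<and> (fro_norm E)\<^sup>2 =
            (fro_norm (1\<^sub>m \<rho> + transpose_mat U1 * D * V1))\<^sup>2
            + (fro_norm (transpose_mat U1 * D * V2))\<^sup>2
            + (fro_norm (transpose_mat U2 * D * V1))\<^sup>2
            + w)
     \<and>
     (\<forall>d T b Lstar Fbound E.
        mat_linear_operator m n d T \<longrightarrow>
        b \<in> carrier_vec d \<longrightarrow>
        (\<forall>X\<in>carrier_mat m n.
           is_min_value (\<lambda>S. 1/2 * (vec_norm2 (T (X + S) - b))\<^sup>2 + entry_l1_norm S)
             (carrier_mat m n) (\<phi> X)) \<longrightarrow>
        Lstar \<in> carrier_mat m n \<longrightarrow>
        (\<forall>X\<in>carrier_mat m n. F Lstar \<le> F X) \<longrightarrow>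
        F Lstar \<le> Fbound \<longrightarrow>
        E \<in> subdifferential m n nuclear_norm L + subdifferential m n \<phi> L \<longrightarrow>
        is_min_value (\<lambda>X. (fro_norm (X + D))\<^sup>2) (subdifferential m n nuclear_norm L)
          ((fro_norm E)\<^sup>2) \<longrightarrow>
        F L - F Lstar \<le> fro_norm E * fro_norm (L - Lstar)
        \<and> fro_norm E * fro_norm (L - Lstar) \<le> fro_norm E * (fro_norm L + Fbound))"
    (is "?sum \<and> ?min \<and> ?bound")
proof (intro conjI)
  show sum_rule: ?sum
    unfolding F by (rule subdifferential_sum_rule[OF mat_convex_nuclear_norm convex L])
  have LU: "L = U1 * \<Sigma>1 * transpose_mat V1" by (rule full_svdD(3)[OF svd])
  interpret S: svd_split m n \<rho> U1 U2 V1 V2 \<Sigma>1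
    by unfold_locales (use full_svdD[OF svd] svd in \<open>auto simp: full_svd_def\<close>)
  note u = S.u and v = S.v
  have Dc: "D \<in> carrier_mat m n" using D by (rule subdifferentialD)
  let ?M = "transpose_mat U2 * D * V2" and ?B = "{W \<in> carrier_mat (m - \<rho>) (n - \<rho>). spectral_norm W \<le> 1}"
  let ?sub = "subdifferential m n nuclear_norm L"
  let ?c = "(fro_norm (1\<^sub>m \<rho> + transpose_mat U1 * D * V1))\<^sup>2
            + (fro_norm (transpose_mat U1 * D * V2))\<^sup>2 + (fro_norm (transpose_mat U2 * D * V1))\<^sup>2"
  have M: "?M \<in> carrier_mat (m - \<rho>) (n - \<rho>)" using u(2) v(2) Dc by auto
  obtain w where w: "is_min_value (\<lambda>W. (fro_norm (?M - W))\<^sup>2) ?B w"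
    using spectral_ball_projection[OF M] by blast
  then obtain W where W: "W \<in> carrier_mat (m - \<rho>) (n - \<rho>)" "spectral_norm W \<le> 1"
    and Ww: "(fro_norm (?M - W))\<^sup>2 = w" by (auto simp: is_min_value_def)
  have mW: "- W \<in> carrier_mat (m - \<rho>) (n - \<rho>)" using W(1) by simp
  \<comment> \<open>The free block is \<open>- W\<close>, so that adding \<open>D\<close> leaves \<open>U2\<^sup>T D V2 - W\<close> in it.\<close>
  define X where "X = U1 * transpose_mat V1 + U2 * (- W) * transpose_mat V2"
  note Xb = S.blocks_of_combination[OF mW, folded X_def]
  have "contraction (n - \<rho>) (- W)"
    using W by (simp add: contraction_uminus spectral_norm_le_1_iff_contraction)
  then have X: "X \<in> ?sub"
    unfolding LU S.subdifferential_nuclear_norm_iff using Xb by simp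
  have XD: "(fro_norm (X + D))\<^sup>2 = ?c + w"
    unfolding S.fro_norm_sq_subgradient_add[OF X[unfolded LU] Dc] Xb(5) using W(1) Ww by simp
  have least: "?c + w \<le> (fro_norm (Y + D))\<^sup>2" if Y: "Y \<in> ?sub" for Y
  proof -
    let ?Y = "transpose_mat U2 * Y * V2"
    have Yc: "?Y \<in> carrier_mat (m - \<rho>) (n - \<rho>)" and cY: "contraction (n - \<rho>) ?Y"
      using Y u(2) v(2) unfolding LU S.subdifferential_nuclear_norm_iff by auto
    have "- ?Y \<in> ?B"
      using Yc cY spectral_norm_le_1_iff_contraction[of "- ?Y"] contraction_uminus[OF Yc] by auto
    then have "w \<le> (fro_norm (?M - - ?Y))\<^sup>2" using w by (auto simp: is_min_value_def)
    then show ?thesis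
      unfolding S.fro_norm_sq_subgradient_add[OF Y[unfolded LU] Dc] by simp
  qed
  have "is_min_value (\<lambda>X. (fro_norm (X + D))\<^sup>2) ?sub ((fro_norm (X + D))\<^sup>2)"
    unfolding is_min_value_def using X least XD by auto
  moreover have "X + D \<in> ?sub + subdifferential m n \<phi> L" using X D by (rule set_plus_intro)
  ultimately show ?min using w XD by blast
  show ?bound
  proof (intro allI impI conjI)
    fix d :: nat and T :: "real mat \<Rightarrow> real vec" and b :: "real vec"
      and Lstar E :: "real mat" and Fbound :: real
    assume phi: "\<forall>X\<in>carrier_mat m n.
           is_min_value (\<lambda>S. 1/2 * (vec_norm2 (T (X + S) - b))\<^sup>2 + entry_l1_norm S)
             (carrier_mat m n) (\<phi> X)"
      and Ls: "Lstar \<in> carrier_mat m n" and Fb: "F Lstar \<le> Fbound"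
      and E: "E \<in> ?sub + subdifferential m n \<phi> L"
    note E = subdifferentialD[OF E[unfolded sum_rule]]
    have LL: "L - Lstar \<in> carrier_mat m n" using Ls by (rule minus_carrier_mat)
    \<comment> \<open>By the sum rule, \<open>E\<close> is a subgradient of \<open>F\<close>; compare with its value at \<open>Lstar\<close>.\<close>
    have "F L - F Lstar \<le> - trace_inner E (Lstar - L)" using E(2)[OF Ls] by simp
    also have "\<dots> = trace_inner E (L - Lstar)"
      by (simp add: trace_inner_diff_right[OF E(1) L Ls] trace_inner_diff_right[OF E(1) Ls L])
    also have "\<dots> \<le> fro_norm E * fro_norm (L - Lstar)" by (rule trace_inner_le_fro_norm[OF E(1) LL])
    finally show "F L - F Lstar \<le> fro_norm E * fro_norm (L - Lstar)" .
    \<comment> \<open>As an attained minimum of nonnegative values, \<open>\<phi> Lstar\<close> is nonnegative, so \<open>Fbound\<close> is an upper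
      bound of the nuclear norm of \<open>Lstar\<close>, which in turn dominates the Frobenius norm.\<close>
    obtain S where "1/2 * (vec_norm2 (T (Lstar + S) - b))\<^sup>2 + entry_l1_norm S = \<phi> Lstar"
      using phi Ls unfolding is_min_value_def by blast
    moreover have "entry_l1_norm S \<ge> 0" by (simp add: entry_l1_norm_def sum_nonneg)
    ultimately have "\<phi> Lstar \<ge> 0"
      using zero_le_power2[of "vec_norm2 (T (Lstar + S) - b)"] by linarith
    then have "fro_norm Lstar \<le> Fbound"
      using fro_norm_le_nuclear_norm[OF Ls] Fb by (simp add: F)
    then have "fro_norm (L - Lstar) \<le> fro_norm L + Fbound"
      using fro_norm_diff_triangle[OF L Ls] by simp
    then show "fro_norm E * fro_norm (L - Lstar) \<le> fro_norm E * (fro_norm L + Fbound)"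
      by (rule mult_left_mono) (rule fro_norm_nonneg)
  qed
qed

end
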